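(* Let $M=G/K$ be a compact symmetric space, where $G$ is a compact Lie group realized as a closed subgroup of the orthogonal group $O(\mathbb{R}^N)$, and $M$ is identified with the orbit $G\cdot v$ of a unit vector $v\in\mathbb{R}^N$ ($K$ the stabilizer of $v$). Let $\mathbf{P}_n(M)$ be the space of restrictions to $M$ of polynomials on $\mathbb{R}^N$ of degree at most $n$. Let $X_1,\dots,X_d$ be an orthonormal basis of the Lie algebra $\mathfrak{g}$ of $G$ (skew-symmetric $N\times N$ matrices) with respect to $\langle X,Y\rangle=-\frac12\operatorname{tr}(XY)$, and for $1\le p\le\infty$ let $D_j$ be the generator in $L_p(M)$ of the group $f\mapsto f(\exp(tX_j)\cdot x)$. Then for every $1\le p\le\infty$ and every $n\in\mathbb{N}$, $$\mathbf{P}_n(M)\subset\mathbf{B}^p_n(\mathbb{D}),$$ i.e. every $f\in\mathbf{P}_n(M)$ satisfies $\|D_{j_1}\cdots D_{j_k}f\|_p\le n^k\|f\|_p$ for all $k\in\mathbb{N}$ and all $1\le j_1,\dots,j_k\le d$.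
   Context: $L_p(M)$ is taken with respect to the $G$-invariant measure on $M$. $\mathbf{B}^p_\omega(\mathbb{D})$ denotes the set of $f\in L_p(M)$ in the domain of all finite products of the $D_j$ with $\|D_{i_1}\cdots D_{i_k}f\|_p\le\omega^k\|f\|_p$ for all $k$ and indices. *)

theory Defs
  imports "HOL-Analysis.Analysis" "HOL-Probability.Probability"
begin

type_synonym 'n mat = "real^'n^'n"

primrec mpow :: "'n::finite mat \<Rightarrow> nat \<Rightarrow> 'n mat" where
  "mpow A 0 = mat 1"
| "mpow A (Suc k) = A ** mpow A k"

definition mexp :: "'n::finite mat \<Rightarrow> 'n mat" where
  "mexp X = (\<Sum>k. scaleR (1 / (fact k :: real)) (mpow X k))"

definition closed_orth_subgroup :: "'n::finite mat set \<Rightarrow> bool" where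
  "closed_orth_subgroup G \<longleftrightarrow>
     G \<subseteq> {A. orthogonal_matrix A} \<and> mat 1 \<in> G \<and>
     (\<forall>A\<in>G. \<forall>B\<in>G. A ** B \<in> G) \<and> (\<forall>A\<in>G. matrix_inv A \<in> G) \<and> closed G"

definition lie_alg :: "'n::finite mat set \<Rightarrow> 'n mat set" where
  "lie_alg G = {X. \<forall>t::real. mexp (scaleR t X) \<in> G}"

definition lie_inner :: "'n::finite mat \<Rightarrow> 'n mat \<Rightarrow> real" where
  "lie_inner X Y = - (1/2) * trace (X ** Y)"

definition lie_onb :: "'n::finite mat set \<Rightarrow> nat \<Rightarrow> (nat \<Rightarrow> 'n mat) \<Rightarrow> bool" where
  "lie_onb G d Xs \<longleftrightarrow>
     (\<forall>i<d. Xs i \<in> lie_alg G) \<and>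
     (\<forall>i<d. \<forall>j<d. lie_inner (Xs i) (Xs j) = (if i = j then 1 else 0)) \<and>
     lie_alg G \<subseteq> span (Xs ` {..<d})"

definition stabilizer :: "'n::finite mat set \<Rightarrow> real^'n \<Rightarrow> 'n mat set" where
  "stabilizer G v = {g\<in>G. g *v v = v}"

definition symmetric_pair :: "'n::finite mat set \<Rightarrow> 'n mat set \<Rightarrow> bool" where
  "symmetric_pair G K \<longleftrightarrow>
     (\<exists>\<sigma>. \<sigma> ` G \<subseteq> G \<and> continuous_on G \<sigma> \<and>
        (\<forall>g\<in>G. \<forall>h\<in>G. \<sigma> (g ** h) = \<sigma> g ** \<sigma> h) \<and>
        (\<forall>g\<in>G. \<sigma> (\<sigma> g) = g) \<and>
        connected_component_set {g\<in>G. \<sigma> g = g} (mat 1) \<subseteq> K \<and>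
        K \<subseteq> {g\<in>G. \<sigma> g = g})"

definition invariant_measure :: "'n::finite mat set \<Rightarrow> (real^'n) set \<Rightarrow> (real^'n) measure \<Rightarrow> bool" where
  "invariant_measure G M \<mu> \<longleftrightarrow>
     sets \<mu> = sets (restrict_space borel M) \<and> space \<mu> = M \<and>
     0 < emeasure \<mu> M \<and> emeasure \<mu> M < \<infinity> \<and>
     (\<forall>g\<in>G. \<forall>A\<in>sets \<mu>. emeasure \<mu> ((\<lambda>x. g *v x) ` A) = emeasure \<mu> A)"

definition lpnorm :: "'a measure \<Rightarrow> ennreal \<Rightarrow> ('a \<Rightarrow> complex) \<Rightarrow> ennreal" where
  "lpnorm \<mu> p f =
     (if p = \<infinity> then esssup \<mu> (\<lambda>x. ennreal (cmod (f x)))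
      else (let I = (\<integral>\<^sup>+ x. ennreal (cmod (f x) powr enn2real p) \<partial>\<mu>)
            in if I = \<infinity> then \<infinity> else ennreal (enn2real I powr (1 / enn2real p))))"

definition memLp :: "'a measure \<Rightarrow> ennreal \<Rightarrow> ('a \<Rightarrow> complex) \<Rightarrow> bool" where
  "memLp \<mu> p f \<longleftrightarrow> f \<in> borel_measurable \<mu> \<and> lpnorm \<mu> p f < \<infinity>"

text \<open>g is the image of h under the L_p generator of the group f \<mapsto> f(exp(tX).x).\<close>
definition has_gen :: "(real^'n) measure \<Rightarrow> ennreal \<Rightarrow> 'n::finite mat
                        \<Rightarrow> (real^'n \<Rightarrow> complex) \<Rightarrow> (real^'n \<Rightarrow> complex) \<Rightarrow> bool" where
  "has_gen \<mu> p X h g \<longleftrightarrow> memLp \<mu> p h \<and> memLp \<mu> p g \<and>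
     ((\<lambda>t::real. lpnorm \<mu> p (\<lambda>x. (h (mexp (scaleR t X) *v x) - h x) / of_real t - g x))
        \<longlongrightarrow> 0) (at 0)"

fun gen_chain :: "(real^'n) measure \<Rightarrow> ennreal \<Rightarrow> (nat \<Rightarrow> 'n::finite mat) \<Rightarrow> nat list
                   \<Rightarrow> (real^'n \<Rightarrow> complex) \<Rightarrow> (real^'n \<Rightarrow> complex) \<Rightarrow> bool" where
  "gen_chain \<mu> p Xs [] f g \<longleftrightarrow> memLp \<mu> p f \<and> g = f"
| "gen_chain \<mu> p Xs (j # js) f g \<longleftrightarrow> (\<exists>h. gen_chain \<mu> p Xs js f h \<and> has_gen \<mu> p (Xs j) h g)"

definition poly_deg_le :: "nat \<Rightarrow> (real^'n::finite \<Rightarrow> complex) \<Rightarrow> bool" where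
  "poly_deg_le n P \<longleftrightarrow>
     (\<exists>c :: ('n \<Rightarrow> nat) \<Rightarrow> complex. finite {a. c a \<noteq> 0} \<and>
        (\<forall>a. c a \<noteq> 0 \<longrightarrow> (\<Sum>i\<in>UNIV. a i) \<le> n) \<and>
        (\<forall>x. P x = (\<Sum>a\<in>{a. c a \<noteq> 0}. c a * (\<Prod>i\<in>UNIV. of_real (x $ i) ^ a i))))"

definition bernstein_space :: "(real^'n) measure \<Rightarrow> ennreal \<Rightarrow> nat \<Rightarrow> (nat \<Rightarrow> 'n::finite mat)
                                \<Rightarrow> real \<Rightarrow> (real^'n \<Rightarrow> complex) set" where
  "bernstein_space \<mu> p d Xs \<omega> = {f. memLp \<mu> p f \<and>
     (\<forall>js. set js \<subseteq> {..<d} \<longrightarrow>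
        (\<exists>g. gen_chain \<mu> p Xs js f g) \<and>
        (\<forall>g. gen_chain \<mu> p Xs js f g \<longrightarrow>
              lpnorm \<mu> p g \<le> ennreal (\<omega> ^ length js) * lpnorm \<mu> p f))}"

end

theory Submission
  imports Defs "HOL-Complex_Analysis.Complex_Analysis"
begin

text \<open>
  A unit generator X is skew with Hilbert-Schmidt norm squared 2; its eigenvalues come in pairs
  of opposite sign, so its operator norm is at most 1. Hence along a point x of the unit sphere
  each coordinate of exp(sX)x extends to an entire function of s bounded by exp |Im s|, and a
  polynomial of degree at most n extends to an entire function F bounded by C exp(n |Im s|).
  Integrating F(z/n)/(z^2 cos z) over the circles of radius m pi yields M. Riesz' interpolation
  formula, which writes F'(0) as a series in the values F(t) at real t with coefficients of total
  mass n (the mass is read off from F = sin). Each F(t) is the value at x of a translate of the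
  polynomial by an isometry of L_p, so convexity of the L_p norm gives Bernstein's inequality for
  one derivative. As the Lie derivative of a polynomial of degree at most n is again such a
  polynomial, the inequality iterates.
\<close>

section \<open>Interpolation of functions of exponential type\<close>

text \<open>The obstacle is to cover every exponent at once, \<open>p = \<infinity>\<close>
  included, with the sharp constant \<open>n\<close>. An identity at each point of the orbit whose
  coefficients do not depend on the point achieves this: it passes to any norm that is invariant
  under the flow, convex and lower semicontinuous along pointwise limits. Accordingly the series
  enters through its finite partial sums, which are estimated by convexity before the limit is
  taken. The growth constant \<open>C\<close> makes the contour integrals vanish and error bounds
  uniform on the unit ball; it never reaches the final estimate. A second obstacle comes from the
  encoding: functions equal almost everywhere are not identified, so \<open>gen_chain\<close> is a
  relation with many values and the norm bound must hold for each of them. Uniqueness almost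
  everywhere is therefore proved along with existence. The nodes are the positive zeros of cosine;
  with their negatives they are the poles of the Riesz kernel away from 0.\<close>

definition node :: "nat \<Rightarrow> real" where
  "node k = (real k + 1/2) * pi"

lemma node_pos: "0 < node k"
  by (simp add: node_def)

lemma node_neq_0: "node k \<noteq> 0"
  using node_pos[of k] by simp

lemma cos_node: "cos (node k) = 0" and sin_node: "sin (node k) = (- 1) ^ k"
  by (simp_all add: node_def distrib_right cos_add sin_add)

lemma inj_node: "node j = node k \<longleftrightarrow> j = k"
  by (simp add: node_def)

text \<open>The square of |cos z| is cos(Re z)^2 + sinh(Im z)^2. Away from the real axis sinh
  dominates; near it, a point of the circle is close to m pi or -m pi, where cosine is 1 or -1. This
  is why the radii are multiples of pi, midway between consecutive zeros.\<close>

lemma norm_cos_ge_on_circle: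
  assumes "0 < m" "cmod z = real m * pi"
  shows "exp \<bar>Im z\<bar> / 4 \<le> cmod (cos z)"
proof (cases "1/2 \<le> \<bar>Im z\<bar>")
  case True
  define e where "e = exp \<bar>Im z\<bar>"
  have "(2::real) \<le> exp 1" using exp_ge_add_one_self[of 1] by simp
  also have "exp 1 \<le> exp (\<bar>Im z\<bar> + \<bar>Im z\<bar>)" using True by (subst exp_le_cancel_iff) linarith
  finally have "2 \<le> e * e" by (simp only: e_def exp_add)
  moreover have "0 < e" by (simp add: e_def)
  ultimately have e: "1 / e \<le> e / 2" by (simp add: field_simps)
  have "(exp (Im z) - inverse (exp (Im z)))\<^sup>2 = (e - 1/e)\<^sup>2"
    by (cases "0 \<le> Im z") (auto simp: e_def exp_minus divide_inverse power2_commute)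
  then have "(e - 1/e)\<^sup>2 / 4 \<le> (cmod (cos z))\<^sup>2"
    by (simp add: norm_cos_squared)
  moreover have "(e/2)\<^sup>2 \<le> (e - 1/e)\<^sup>2"
    using e \<open>0 < e\<close> by (intro power_mono) auto
  ultimately have "(e/4)\<^sup>2 \<le> (cmod (cos z))\<^sup>2" by (simp add: power_divide)
  then show ?thesis unfolding e_def using power2_le_imp_le by (metis norm_ge_zero)
next
  case False
  then have y: "\<bar>Im z\<bar> < 1/2" by simp
  define d where "d = real m * pi - \<bar>Re z\<bar>"
  have mp: "3 \<le> real m * pi" using assms(1) pi_gt3 mult_mono[of 1 "real m" 3 pi] by simp
  have d0: "0 \<le> d" using abs_Re_le_cmod[of z] assms(2) by (simp add: d_def)
  \<comment> \<open>Difference of squares: \<open>d\<close>, the gap between |Re z| and the radius,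
    is quadratically small in Im z.\<close>
  have "(real m * pi)\<^sup>2 = (Re z)\<^sup>2 + (Im z)\<^sup>2" using assms(2) cmod_power2[of z] by simp
  then have "d * (real m * pi + \<bar>Re z\<bar>) = \<bar>Im z\<bar> * \<bar>Im z\<bar>"
    by (simp add: d_def algebra_simps power2_eq_square)
  moreover have "\<bar>Im z\<bar> * \<bar>Im z\<bar> \<le> 1/2 * (1/2)" using y by (intro mult_mono) auto
  moreover have "d * 3 \<le> d * (real m * pi + \<bar>Re z\<bar>)" using d0 mp by (intro mult_left_mono) auto
  ultimately have d1: "d \<le> 1/12" by simp
  have cosd: "1/2 \<le> cos d"
    using cos_monotone_0_pi_le[of d "pi/3"] d0 d1 pi_gt3 by (simp add: cos_60)
  have "cos (Re z) = cos \<bar>Re z\<bar>" by (simp add: abs_if)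
  also have "\<bar>Re z\<bar> = real m * pi - d" by (simp add: d_def)
  also have "cos (real m * pi - d) = cos (real m * pi) * cos d" by (simp add: cos_diff)
  finally have "\<bar>cos (Re z)\<bar> = cos d" using cosd by (simp add: abs_mult cos_npi)
  then have "1/2 \<le> \<bar>cos (Re z)\<bar>" using cosd by simp
  then have "(1/2)\<^sup>2 \<le> \<bar>cos (Re z)\<bar>\<^sup>2" by (intro power_mono) auto
  also have "\<dots> \<le> (cmod (cos z))\<^sup>2" unfolding norm_cos_squared by simp
  finally have "1/2 \<le> cmod (cos z)" using power2_le_imp_le norm_ge_zero by blast
  moreover have "exp \<bar>Im z\<bar> \<le> 2"
    using exp_bound_half[of "\<bar>Im z\<bar>"] y by simp
  ultimately show ?thesis by simp
qed

lemma cos_eq_0_imp_node: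
  fixes z :: complex
  assumes "cos z = 0"
  obtains k where "z = of_real (node k) \<or> z = - of_real (node k)"
proof -
  obtain n :: int where n: "z = complex_of_real (n * pi) + of_real pi/2"
    using assms cos_eq_0 by blast
  show ?thesis
  proof (cases "0 \<le> n")
    case True
    then have "z = of_real (node (nat n))" by (simp add: n node_def distrib_right)
    then show ?thesis using that by blast
  next
    case False
    \<comment> \<open>Reflection about 0 sends the half-integer n + 1/2 to (-n - 1) + 1/2, whence
      the shift by one.\<close>
    then have "z = - of_real (node (nat (- n - 1)))" by (simp add: n node_def algebra_simps)
    then show ?thesis using that by blast
  qed
qed

text \<open>Zeros of cosine are simple, so the residue is F(a) divided by the derivative of cosine
  at a. \<open>F\<close> may be singular at 0 because the lemma is applied to a numerator that
  already contains the factor 1/z^2.\<close>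

lemma residue_div_cos:
  assumes "F holomorphic_on - {0}" "a \<noteq> 0" "cos a = 0"
  shows "residue (\<lambda>z. F z / cos z) a = - (F a / sin a)"
proof -
  \<comment> \<open>Radius at most |a| keeps the singularity 0 out; radius at most 1 keeps out the
    other zeros of cosine, which are at least pi away.\<close>
  define U where "U = ball a (min (cmod a) 1)"
  have U: "open U" "a \<in> U" "0 \<notin> U" using assms(2) by (auto simp: U_def)
  have "cos z \<noteq> 0" if "z \<in> U - {a}" for z
  proof
    assume "cos z = 0"
    have d: "dist a z < 1" "z \<noteq> a" using that by (auto simp: U_def)
    obtain n m :: int where n: "z = complex_of_real (n * pi) + of_real pi/2"
      and m: "a = complex_of_real (m * pi) + of_real pi/2"
      using \<open>cos z = 0\<close> assms(3) cos_eq_0 by meson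
    have "a - z = of_real ((m - n) * pi)" unfolding n m by (simp add: algebra_simps)
    then have "dist a z = \<bar>real_of_int (m - n)\<bar> * pi"
      by (metis abs_mult abs_of_pos dist_norm norm_of_real pi_gt_zero)
    moreover have "1 \<le> \<bar>real_of_int (m - n)\<bar>" using d(2) n m by (cases "m = n") auto
    ultimately have "1 * pi \<le> dist a z" by (simp add: mult_right_mono)
    then show False using d(1) pi_gt3 by simp
  qed
  then have hol: "(\<lambda>z. F z / cos z) holomorphic_on U - {a}"
    using U by (auto intro!: holomorphic_intros holomorphic_on_subset[OF assms(1)])
  have sa: "sin a \<noteq> 0" using assms(3) sin_cos_squared_add[of a] by auto
  have "((\<lambda>z. (cos z - cos a) / (z - a)) \<longlongrightarrow> - sin a) (at a)"
    using DERIV_cos[of a] by (simp add: has_field_derivative_iff)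
  moreover have "(F \<longlongrightarrow> F a) (at a)"
    using holomorphic_on_imp_continuous_on[OF assms(1)] assms(2)
    by (metis (no_types, lifting) ComplI continuous_on_eq_continuous_at isCont_def open_Compl
        closed_singleton singletonD)
  ultimately have "((\<lambda>z. F z / ((cos z - cos a) / (z - a))) \<longlongrightarrow> F a / - sin a) (at a)"
    using sa by (intro tendsto_divide) auto
  then have "((\<lambda>z. F z / cos z * (z - a)) \<longlongrightarrow> - (F a / sin a)) (at a)"
    by (simp add: assms(3))
  then show ?thesis using U hol by (intro residue_simple')
qed

text \<open>On the circle of radius m pi the residue theorem makes \<open>deriv F 0 - S m\<close> an
  exact contour integral. Growth of \<open>F\<close> cancels against that of cosine, leaving O(1/m).
  Sine takes opposite values at a node and its negative, which produces the differences in the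
  sum.\<close>

lemma exponential_type_interpolation:
  assumes hol: "F holomorphic_on UNIV"
    and bound: "\<And>z. cmod (F z) \<le> C * exp \<bar>Im z\<bar>"
  shows "(\<lambda>m. \<Sum>k<m. (-1)^k * (F (of_real (node k)) - F (- of_real (node k)))
            / of_real ((node k)\<^sup>2)) \<longlonglongrightarrow> deriv F 0"
proof -
  define S where "S m = (\<Sum>k<m. (-1)^k * (F (of_real (node k)) - F (- of_real (node k)))
            / of_real ((node k)\<^sup>2))" for m
  define f where "f = (\<lambda>z. F z / z\<^sup>2 / cos z)"
  have C: "0 \<le> C" using bound[of 0] by (metis abs_zero exp_zero mult.right_neutral norm_ge_zero order_trans zero_complex.simps(2))
  have est: "cmod (deriv F 0 - S m) \<le> 4 * C / pi / real m" if m: "0 < m" for m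
  proof -
    define R where "R = real m * pi"
    have R: "0 < R" using m by (simp add: R_def)
    define N where "N = (\<lambda>k. complex_of_real (node k)) ` {..<m}"
    define N' where "N' = (\<lambda>k. - complex_of_real (node k)) ` {..<m}"
    define pts where "pts = insert 0 (N \<union> N')"
    \<comment> \<open>An open disc around the closed contour disc that admits no further pole: the
      next zero of cosine has modulus R + pi/2, more than R + 1.\<close>
    define D where "D = ball (0::complex) (R + 1)"
    have node_lt: "node k < R \<longleftrightarrow> k < m" for k
    proof -
      have "node k < R \<longleftrightarrow> real k + 1/2 < real m" by (simp add: node_def R_def)
      then show ?thesis by linarith
    qed
    have node_D: "node k < R + 1 \<Longrightarrow> k < m" for k
    proof (rule ccontr)
      assume "node k < R + 1" "\<not> k < m"
      then have "(real m + 1/2) * pi \<le> node k" unfolding node_def by (intro mult_right_mono) auto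
      with \<open>node k < R + 1\<close> show False using pi_gt3 by (simp add: R_def distrib_right)
    qed
    have fin: "finite pts" by (simp add: pts_def N_def N'_def)
    have nz: "cos z \<noteq> 0" if "z \<in> D" "z \<notin> pts" for z
    proof
      assume "cos z = 0"
      then obtain k where k: "z = of_real (node k) \<or> z = - of_real (node k)"
        using cos_eq_0_imp_node by blast
      then have "node k < R + 1" using that(1) node_pos[of k] by (auto simp: D_def)
      then show False using node_D[of k] k that(2) by (auto simp: pts_def N_def N'_def)
    qed
    have holf: "f holomorphic_on D - pts" unfolding f_def
      using nz by (auto intro!: holomorphic_intros holomorphic_on_subset[OF hol] simp: pts_def)
    have in_ball: "norm z < R" if "z \<in> pts" for z
      using that node_lt node_pos R by (auto simp: pts_def N_def N'_def abs_of_pos)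
    have I: "contour_integral (circlepath 0 R) f
        = 2 * pi * \<i> * (\<Sum>z\<in>pts. winding_number (circlepath 0 R) z * residue f z)"
    proof (rule Residue_theorem[OF _ _ fin holf])
      show "path_image (circlepath 0 R) \<subseteq> D - pts" using R by (auto simp: D_def dest: in_ball)
      show "\<forall>z. z \<notin> D \<longrightarrow> winding_number (circlepath 0 R) z = 0"
        using R by (auto simp: D_def intro!: winding_number_zero_outside[of _ "cball 0 R"])
    qed (auto simp: D_def)
    also have "(\<Sum>z\<in>pts. winding_number (circlepath 0 R) z * residue f z) = (\<Sum>z\<in>pts. residue f z)"
      using in_ball by (intro sum.cong refl) (simp add: winding_number_circlepath)
    also have "\<dots> = residue f 0 + ((\<Sum>z\<in>N. residue f z) + (\<Sum>z\<in>N'. residue f z))"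
    proof -
      have "0 \<notin> N \<union> N'" by (auto simp: N_def N'_def node_neq_0)
      moreover have "N \<inter> N' = {}"
      proof -
        have "complex_of_real (node j) \<noteq> - complex_of_real (node k)" for j k
          using node_pos[of j] node_pos[of k]
          by (metis add.inverse_inverse less_asym neg_0_less_iff_less of_real_eq_iff of_real_minus)
        then show ?thesis by (auto simp: N_def N'_def)
      qed
      ultimately show ?thesis unfolding pts_def
        by (simp add: sum.union_disjoint N_def N'_def)
    qed
    also have "(\<Sum>z\<in>N. residue f z) = (\<Sum>k<m. - ((-1)^k * F (of_real (node k)) / of_real ((node k)\<^sup>2)))"
      unfolding N_def
    proof (subst sum.reindex)
      show "inj_on (\<lambda>k. complex_of_real (node k)) {..<m}" by (auto simp: inj_on_def inj_node)
      show "sum (residue f \<circ> (\<lambda>k. complex_of_real (node k))) {..<m}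
          = (\<Sum>k<m. - ((-1)^k * F (of_real (node k)) / of_real ((node k)\<^sup>2)))"
      proof (intro sum.cong refl)
        fix k
        have "residue f (of_real (node k)) = - (F (of_real (node k)) / (of_real (node k))\<^sup>2 / sin (of_real (node k)))"
          unfolding f_def
          using node_pos[of k] cos_node[of k]
          by (intro residue_div_cos)
             (auto intro!: holomorphic_intros holomorphic_on_subset[OF hol] simp: cos_of_real)
        also have "sin (complex_of_real (node k)) = (-1)^k" by (simp add: sin_of_real sin_node)
        finally show "(residue f \<circ> (\<lambda>k. complex_of_real (node k))) k
          = - ((-1)^k * F (of_real (node k)) / of_real ((node k)\<^sup>2))"
          by (cases "even k") auto
      qed
    qed
    also have "(\<Sum>z\<in>N'. residue f z) = (\<Sum>k<m. (-1)^k * F (- of_real (node k)) / of_real ((node k)\<^sup>2))"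
      unfolding N'_def
    proof (subst sum.reindex)
      show "inj_on (\<lambda>k. - complex_of_real (node k)) {..<m}" by (auto simp: inj_on_def inj_node)
      show "sum (residue f \<circ> (\<lambda>k. - complex_of_real (node k))) {..<m}
          = (\<Sum>k<m. (-1)^k * F (- of_real (node k)) / of_real ((node k)\<^sup>2))"
      proof (intro sum.cong refl)
        fix k
        have "residue f (- of_real (node k)) = - (F (- of_real (node k)) / (- of_real (node k))\<^sup>2 / sin (- of_real (node k)))"
          unfolding f_def
          using node_pos[of k] cos_node[of k]
          by (intro residue_div_cos)
             (auto intro!: holomorphic_intros holomorphic_on_subset[OF hol] simp: cos_of_real)
        also have "sin (- complex_of_real (node k)) = - ((-1)^k)" by (simp add: sin_of_real sin_node)
        finally show "(residue f \<circ> (\<lambda>k. - complex_of_real (node k))) k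
          = (-1)^k * F (- of_real (node k)) / of_real ((node k)\<^sup>2)"
          by (cases "even k") auto
      qed
    qed
    \<comment> \<open>At the double pole the residue is the derivative of F / cos at 0, and cosine
      is 1 with vanishing derivative there.\<close>
    also have "residue f 0 = deriv F 0"
    proof -
      have cz: "cos z \<noteq> 0" if "z \<in> ball 0 1" for z :: complex
      proof
        assume "cos z = 0"
        then obtain k where k: "z = of_real (node k) \<or> z = - of_real (node k)"
          using cos_eq_0_imp_node by blast
        then have "node k < 1" using that node_pos[of k] by auto
        moreover have "1/2 * pi \<le> node k" unfolding node_def by (intro mult_right_mono) auto
        ultimately show False using pi_gt3 by simp
      qed
      have "residue f 0 = residue (\<lambda>z. (F z / cos z) / z ^ Suc 1) 0"
        by (rule arg_cong[where f = "\<lambda>f. residue f 0"]) (auto simp: f_def power2_eq_square)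
      also have "\<dots> = (deriv ^^ 1) (\<lambda>z. F z / cos z) 0 / fact 1"
        using cz by (intro residue_holomorphic_over_power'[of "ball 0 1"])
          (auto intro!: holomorphic_intros holomorphic_on_subset[OF hol])
      also have "\<dots> = deriv F 0"
      proof -
        have "(F has_field_derivative deriv F 0) (at 0)"
          using hol by (intro holomorphic_derivI[of _ UNIV]) auto
        then have "((\<lambda>z. F z / cos z) has_field_derivative deriv F 0) (at 0)"
          by (auto intro!: derivative_eq_intros)
        then show ?thesis by (simp add: DERIV_imp_deriv)
      qed
      finally show ?thesis .
    qed
    finally have I: "contour_integral (circlepath 0 R) f = 2 * pi * \<i> * (deriv F 0 - S m)"
      by (simp add: S_def sum_negf sum_subtractf diff_divide_distrib right_diff_distrib[of "(-1) ^ _"])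
    have "f holomorphic_on D - pts" by fact
    then have "f contour_integrable_on circlepath 0 R"
      using R
      by (intro contour_integrable_continuous_circlepath)
         (auto intro!: holomorphic_on_imp_continuous_on holomorphic_on_subset[OF holf] simp: D_def dest: in_ball)
    then have "(f has_contour_integral (2 * pi * \<i> * (deriv F 0 - S m))) (circlepath 0 R)"
      using I has_contour_integral_integral by fastforce
    then have "cmod (2 * pi * \<i> * (deriv F 0 - S m)) \<le> (4 * C / R\<^sup>2) * (2 * pi * R)"
    proof (rule has_contour_integral_bound_circlepath)
      fix z assume "cmod (z - 0) = R"
      then have z: "cmod z = R" by simp
      have c: "exp \<bar>Im z\<bar> / 4 \<le> cmod (cos z)"
        using norm_cos_ge_on_circle[of m z] m z by (simp add: R_def)
      have "cmod (f z) = cmod (F z) / cmod (cos z) / R\<^sup>2"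
        by (simp add: f_def norm_divide norm_mult norm_power z)
      also have "\<dots> \<le> C * exp \<bar>Im z\<bar> / (exp \<bar>Im z\<bar> / 4) / R\<^sup>2"
        using c bound[of z] C by (intro divide_right_mono frac_le) auto
      finally show "cmod (f z) \<le> 4 * C / R\<^sup>2" by (simp add: mult.commute)
    qed (use C R in auto)
    moreover have "cmod (2 * pi * \<i> * w) = 2 * pi * cmod w" for w
      by (simp add: norm_mult)
    moreover have "(4 * C / R\<^sup>2) * (2 * pi * R) = 2 * pi * (4 * C / R)"
      using R by (simp add: power2_eq_square)
    ultimately have "2 * pi * cmod (deriv F 0 - S m) \<le> 2 * pi * (4 * C / R)"
      by metis
    then have "cmod (deriv F 0 - S m) \<le> 4 * C / R"
      by (simp only: mult_le_cancel_left_pos pi_gt_zero zero_less_mult_iff zero_less_numeral simp_thms)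
    then show ?thesis by (simp add: R_def field_simps)
  qed
  have "(\<lambda>m. deriv F 0 - S m) \<longlonglongrightarrow> 0"
  proof (rule Lim_null_comparison)
    show "\<forall>\<^sub>F m in sequentially. cmod (deriv F 0 - S m) \<le> 4 * C / pi / real m"
      using eventually_gt_at_top[of 0] by eventually_elim (rule est)
    show "(\<lambda>m. 4 * C / pi / real m) \<longlonglongrightarrow> 0" by (rule lim_const_over_n)
  qed
  from tendsto_diff[OF tendsto_const[of "deriv F 0"] this] show ?thesis
    by (simp add: S_def)
qed

text \<open>For sine the alternating sign cancels the sign of the nodal values, so every term of the
  formula is positive and the partial sums increase to the derivative of sine at 0, which is
  1.\<close>

lemma sum_node_le: "(\<Sum>k<m. 2 / (node k)\<^sup>2) \<le> 1"
proof -
  have "(\<lambda>m. \<Sum>k<m. (-1)^k * (sin (of_real (node k)) - sin (- of_real (node k)))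
            / of_real ((node k)\<^sup>2)) \<longlonglongrightarrow> deriv sin (0::complex)"
  proof (rule exponential_type_interpolation)
    fix z :: complex
    have "cmod (exp (\<i> * z) - exp (- (\<i> * z))) \<le> exp \<bar>Im z\<bar> + exp \<bar>Im z\<bar>"
      by (rule order_trans[OF norm_triangle_ineq4]) (auto simp: abs_if)
    then show "cmod (sin z) \<le> 1 * exp \<bar>Im z\<bar>"
      by (simp add: sin_exp_eq norm_divide norm_mult)
  qed (intro holomorphic_intros)
  moreover have "deriv sin (0::complex) = 1" using DERIV_imp_deriv[OF DERIV_sin, of "0::complex"] by simp
  moreover have "(-1)^k * (sin (of_real (node k)) - sin (- of_real (node k))) / of_real ((node k)\<^sup>2)
      = complex_of_real (2 / (node k)\<^sup>2)" for k
    unfolding sin_minus sin_of_real sin_node by (cases "even k") auto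
  ultimately have "(\<lambda>m. complex_of_real (\<Sum>k<m. 2 / (node k)\<^sup>2)) \<longlonglongrightarrow> of_real 1"
    by (simp only: of_real_sum of_real_1)
  then have L: "(\<lambda>m. \<Sum>k<m. 2 / (node k)\<^sup>2) \<longlonglongrightarrow> 1"
    by (rule tendsto_of_real_iff[THEN iffD1])
  have "mono (\<lambda>m. \<Sum>k<m. 2 / (node k)\<^sup>2)"
    by (intro monoI sum_mono2) auto
  then show ?thesis using L by (rule incseq_le)
qed

section \<open>The L_p norm\<close>

text \<open>Jensen's inequality for t^p with the weights normalised by their sum s; undoing the
  normalisation costs s^(p-1), and s is at most \<open>A\<close>.\<close>

lemma powr_sum_le:
  fixes a y :: "'i \<Rightarrow> real"
  assumes p: "1 \<le> p" and fin: "finite I"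
    and a: "\<And>i. i \<in> I \<Longrightarrow> 0 \<le> a i" and y: "\<And>i. i \<in> I \<Longrightarrow> 0 \<le> y i"
    and A: "sum a I \<le> A"
  shows "(\<Sum>i\<in>I. a i * y i) powr p \<le> A powr (p - 1) * (\<Sum>i\<in>I. a i * y i powr p)"
proof -
  \<comment> \<open>Dropping vanishing terms changes neither sum, and it makes the normalising
    divisor and all arguments of the power strictly positive. If nothing remains, both sides are
    0.\<close>
  define T where "T = {i\<in>I. 0 < a i \<and> 0 < y i}"
  have T: "finite T" "T \<subseteq> I" using fin by (auto simp: T_def)
  have eq: "(\<Sum>i\<in>I. a i * y i) = (\<Sum>i\<in>T. a i * y i)"
    "(\<Sum>i\<in>I. a i * y i powr p) = (\<Sum>i\<in>T. a i * y i powr p)"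
    using fin a y by (auto intro!: sum.mono_neutral_right simp: T_def less_le)
  show ?thesis
  proof (cases "T = {}")
    case True
    then show ?thesis by (simp add: eq)
  next
    case False
    define s where "s = sum a T"
    have s0: "0 < s" unfolding s_def using T False by (intro sum_pos) (auto simp: T_def)
    have "s \<le> A" unfolding s_def using sum_mono2[OF fin T(2), of a] a A by fastforce
    have "(\<Sum>i\<in>T. (a i / s) *\<^sub>R y i) powr p \<le> (\<Sum>i\<in>T. (a i / s) * y i powr p)"
      using T False s0
      by (intro convex_on_sum[OF _ _ powr_convex[OF p]])
         (auto simp: T_def s_def simp flip: sum_divide_distrib)
    then have "((\<Sum>i\<in>T. a i * y i) / s) powr p \<le> (\<Sum>i\<in>T. a i * y i powr p) / s"
      by (simp add: sum_divide_distrib)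
    moreover have "0 \<le> (\<Sum>i\<in>T. a i * y i)" by (intro sum_nonneg) (auto simp: T_def)
    ultimately have "(\<Sum>i\<in>T. a i * y i) powr p / s powr p \<le> (\<Sum>i\<in>T. a i * y i powr p) / s"
      using s0 by (simp add: powr_divide)
    then have "(\<Sum>i\<in>T. a i * y i) powr p \<le> s powr p * ((\<Sum>i\<in>T. a i * y i powr p) / s)"
      using s0 by (simp add: field_simps)
    also have "\<dots> = s powr (p - 1) * (\<Sum>i\<in>T. a i * y i powr p)"
      using s0 by (simp add: powr_diff)
    also have "\<dots> \<le> A powr (p - 1) * (\<Sum>i\<in>T. a i * y i powr p)"
      using s0 \<open>s \<le> A\<close> p by (intro mult_right_mono powr_mono2 sum_nonneg) (auto simp: T_def)
    finally show ?thesis by (simp add: eq)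
  qed
qed

lemma enn2real_ge_1: "1 \<le> p \<Longrightarrow> p \<noteq> \<infinity> \<Longrightarrow> 1 \<le> enn2real p"
  by (cases p) auto

lemma lpnorm_le_iff_infinity:
  assumes p: "p = \<infinity>" and "f \<in> borel_measurable \<mu>" "0 \<le> L"
  shows "lpnorm \<mu> p f \<le> ennreal L \<longleftrightarrow> (AE x in \<mu>. cmod (f x) \<le> L)"
proof
  assume "lpnorm \<mu> p f \<le> ennreal L"
  then show "AE x in \<mu>. cmod (f x) \<le> L"
    using esssup_AE[of "\<lambda>x. ennreal (cmod (f x))" \<mu>] assms(3)
    by (auto simp: lpnorm_def p elim!: eventually_mono dest: order_trans)
next
  assume "AE x in \<mu>. cmod (f x) \<le> L"
  then have "AE x in \<mu>. ennreal (cmod (f x)) \<le> ennreal L"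
    by eventually_elim (rule ennreal_leI)
  then show "lpnorm \<mu> p f \<le> ennreal L"
    using assms(2) by (auto simp: lpnorm_def p)
qed

text \<open>Removes the p-th root and the separate value for a divergent integral, so that later
  estimates can be made on the integral itself.\<close>

lemma lpnorm_le_iff:
  assumes "1 \<le> p" "p \<noteq> \<infinity>" "0 \<le> L"
  shows "lpnorm \<mu> p f \<le> ennreal L \<longleftrightarrow>
    (\<integral>\<^sup>+ x. ennreal (cmod (f x) powr enn2real p) \<partial>\<mu>) \<le> ennreal (L powr enn2real p)"
proof -
  define q where "q = enn2real p"
  have q: "1 \<le> q" using enn2real_ge_1 assms by (simp add: q_def)
  have norm: "lpnorm \<mu> p f = (let I = (\<integral>\<^sup>+ x. ennreal (cmod (f x) powr q) \<partial>\<mu>)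
            in if I = \<infinity> then \<infinity> else ennreal (enn2real I powr (1 / q)))"
    using assms(2) by (simp add: lpnorm_def q_def cong: if_cong)
  show ?thesis
  proof (cases "\<integral>\<^sup>+ x. ennreal (cmod (f x) powr q) \<partial>\<mu>")
    case (real r)
    have "r powr (1/q) \<le> L \<longleftrightarrow> r \<le> L powr q"
    proof
      assume "r powr (1/q) \<le> L"
      then have "(r powr (1/q)) powr q \<le> L powr q" using q by (intro powr_mono2) auto
      then show "r \<le> L powr q" using q real by (simp add: powr_powr)
    next
      assume "r \<le> L powr q"
      then have "r powr (1/q) \<le> (L powr q) powr (1/q)" using q real by (intro powr_mono2) auto
      then show "r powr (1/q) \<le> L" using q assms(3) by (simp add: powr_powr)
    qed
    then show ?thesis using real assms(3) by (simp add: norm q_def[symmetric])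
  next
    case top
    then show ?thesis by (simp add: norm q_def[symmetric] top_unique)
  qed
qed

text \<open>Integrating \<open>powr_sum_le\<close> gives A^(q-1) * A * L^q = (A L)^q for finite
  exponents. The hypothesis on \<open>g\<close> is a pointwise majorant, so signs and phases of
  coefficients are absorbed before the norm is taken. An empty \<open>I\<close> is allowed and
  covers degree 0.\<close>

lemma lpnorm_convex_combination:
  fixes f :: "'i \<Rightarrow> 'a \<Rightarrow> complex"
  assumes p: "1 \<le> p" and fin: "finite I" and a: "\<And>i. i \<in> I \<Longrightarrow> 0 \<le> a i" and A: "sum a I \<le> A"
    and f: "\<And>i. i \<in> I \<Longrightarrow> f i \<in> borel_measurable \<mu>" and g: "g \<in> borel_measurable \<mu>"
    and L: "0 \<le> L" "\<And>i. i \<in> I \<Longrightarrow> lpnorm \<mu> p (f i) \<le> ennreal L"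
    and le: "\<And>x. x \<in> space \<mu> \<Longrightarrow> cmod (g x) \<le> (\<Sum>i\<in>I. a i * cmod (f i x))"
  shows "lpnorm \<mu> p g \<le> ennreal (A * L)"
proof -
  have A0: "0 \<le> A" using A a by (metis order_trans sum_nonneg)
  show ?thesis
  proof (cases "p = \<infinity>")
    case True
    have "AE x in \<mu>. \<forall>i\<in>I. cmod (f i x) \<le> L"
      using L f fin by (intro AE_finite_allI) (auto simp: lpnorm_le_iff_infinity[OF True])
    moreover have "AE x in \<mu>. x \<in> space \<mu>" by (rule AE_space)
    ultimately have "AE x in \<mu>. cmod (g x) \<le> A * L"
    proof eventually_elim
      case (elim x)
      have "cmod (g x) \<le> (\<Sum>i\<in>I. a i * cmod (f i x))" using elim le by blast
      also have "\<dots> \<le> (\<Sum>i\<in>I. a i * L)" using elim a by (intro sum_mono mult_left_mono) auto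
      also have "\<dots> = sum a I * L" by (simp add: sum_distrib_right)
      also have "\<dots> \<le> A * L" using A L by (intro mult_right_mono)
      finally show ?case .
    qed
    then show ?thesis using g A0 L by (simp add: lpnorm_le_iff_infinity[OF True])
  next
    case False
    define q where "q = enn2real p"
    have q: "1 \<le> q" using enn2real_ge_1 p False by (simp add: q_def)
    have I: "(\<integral>\<^sup>+ x. ennreal (cmod (f i x) powr q) \<partial>\<mu>) \<le> ennreal (L powr q)" if "i \<in> I" for i
      using L that by (simp add: q_def flip: lpnorm_le_iff[OF p False])
    have "(\<integral>\<^sup>+ x. ennreal (cmod (g x) powr q) \<partial>\<mu>)
       \<le> (\<integral>\<^sup>+ x. ennreal (A powr (q - 1)) * (\<Sum>i\<in>I. ennreal (a i) * ennreal (cmod (f i x) powr q)) \<partial>\<mu>)"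
    proof (rule nn_integral_mono)
      fix x assume x: "x \<in> space \<mu>"
      have "cmod (g x) powr q \<le> (\<Sum>i\<in>I. a i * cmod (f i x)) powr q"
        using q le[OF x] by (intro powr_mono2) auto
      also have "\<dots> \<le> A powr (q - 1) * (\<Sum>i\<in>I. a i * cmod (f i x) powr q)"
        using q fin a A by (intro powr_sum_le) auto
      finally have "ennreal (cmod (g x) powr q) \<le> ennreal (A powr (q - 1) * (\<Sum>i\<in>I. a i * cmod (f i x) powr q))"
        by (rule ennreal_leI)
      also have "\<dots> = ennreal (A powr (q - 1)) * (\<Sum>i\<in>I. ennreal (a i) * ennreal (cmod (f i x) powr q))"
        using a by (simp add: ennreal_mult sum_nonneg flip: sum_ennreal)
      finally show "ennreal (cmod (g x) powr q) \<le> \<dots>" .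
    qed
    also have "\<dots> = ennreal (A powr (q - 1)) * (\<Sum>i\<in>I. ennreal (a i) * (\<integral>\<^sup>+ x. ennreal (cmod (f i x) powr q) \<partial>\<mu>))"
      using f by (simp add: nn_integral_cmult nn_integral_sum)
    also have "\<dots> \<le> ennreal (A powr (q - 1)) * (\<Sum>i\<in>I. ennreal (a i) * ennreal (L powr q))"
      using I by (intro mult_left_mono sum_mono) auto
    also have "\<dots> = ennreal (A powr (q - 1) * (sum a I * L powr q))"
      using a by (simp add: ennreal_mult sum_nonneg sum_distrib_right flip: sum_ennreal)
    also have "\<dots> \<le> ennreal (A powr (q - 1) * (A * L powr q))"
      using A by (intro ennreal_leI mult_left_mono mult_right_mono) auto
    also have "A powr (q - 1) * (A * L powr q) = (A * L) powr q"
      using A0 L q by (cases "A = 0") (auto simp: powr_mult powr_diff)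
    finally show ?thesis using A0 L by (simp add: lpnorm_le_iff[OF p False] q_def)
  qed
qed

text \<open>What matters is the order of quantifiers: \<open>K\<close>, a power of the total mass
  (or 1 for infinite \<open>p\<close>), is fixed before \<open>f\<close> and \<open>B\<close>, so a
  uniform error tending to 0 also tends to 0 in norm.\<close>

lemma lpnorm_le_of_bounded:
  assumes p: "1 \<le> p" and "emeasure \<mu> (space \<mu>) < \<infinity>"
  obtains K where "0 \<le> K"
    "\<And>f B. f \<in> borel_measurable \<mu> \<Longrightarrow> 0 \<le> B \<Longrightarrow> (\<And>x. x \<in> space \<mu> \<Longrightarrow> cmod (f x) \<le> B)
      \<Longrightarrow> lpnorm \<mu> p f \<le> ennreal (B * K)"
proof -
  obtain r where r: "emeasure \<mu> (space \<mu>) = ennreal r" "0 \<le> r"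
    using assms(2) by (cases "emeasure \<mu> (space \<mu>)") auto
  define K where "K = (if p = \<infinity> then 1 else r powr (1 / enn2real p))"
  have "lpnorm \<mu> p f \<le> ennreal (B * K)"
    if f: "f \<in> borel_measurable \<mu>" and B: "0 \<le> B" "\<And>x. x \<in> space \<mu> \<Longrightarrow> cmod (f x) \<le> B" for f B
  proof (cases "p = \<infinity>")
    case True
    then show ?thesis using B f by (auto simp: lpnorm_le_iff_infinity K_def intro!: AE_I2)
  next
    case False
    define q where "q = enn2real p"
    have q: "1 \<le> q" using enn2real_ge_1 p False by (simp add: q_def)
    have "(\<integral>\<^sup>+ x. ennreal (cmod (f x) powr q) \<partial>\<mu>) \<le> (\<integral>\<^sup>+ x. ennreal (B powr q) \<partial>\<mu>)"
      using B q by (intro nn_integral_mono ennreal_leI powr_mono2) auto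
    also have "\<dots> = ennreal (B powr q * r)" using r by (simp add: ennreal_mult)
    also have "B powr q * r = (B * K) powr q"
      using B q r False by (simp add: powr_mult K_def q_def[symmetric] powr_powr)
    finally show ?thesis using B by (simp add: lpnorm_le_iff[OF p False] q_def K_def)
  qed
  moreover have "0 \<le> K" by (simp add: K_def)
  ultimately show ?thesis using that by blast
qed

lemma lpnorm_AE_cong:
  assumes "f \<in> borel_measurable \<mu>" "g \<in> borel_measurable \<mu>" "AE x in \<mu>. f x = g x"
  shows "lpnorm \<mu> p f = lpnorm \<mu> p g"
proof -
  have "esssup \<mu> (\<lambda>x. ennreal (cmod (f x))) = esssup \<mu> (\<lambda>x. ennreal (cmod (g x)))"
    using assms by (intro esssup_AE_cong) auto
  moreover have "(\<integral>\<^sup>+ x. ennreal (cmod (f x) powr enn2real p) \<partial>\<mu>) = (\<integral>\<^sup>+ x. ennreal (cmod (g x) powr enn2real p) \<partial>\<mu>)"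
    using assms(3) by (intro nn_integral_cong_AE) auto
  ultimately show ?thesis by (simp add: lpnorm_def)
qed

text \<open>Fatou's lemma for finite exponents; for the infinite one, countably many null sets are
  united. It carries norm bounds on partial sums or difference quotients over to their pointwise
  limits.\<close>

lemma lpnorm_limit_le:
  assumes p: "1 \<le> p" and f: "\<And>m. f m \<in> borel_measurable \<mu>" and g: "g \<in> borel_measurable \<mu>"
    and L: "0 \<le> L" "\<And>m. lpnorm \<mu> p (f m) \<le> ennreal L"
    and lim: "AE x in \<mu>. (\<lambda>m. f m x) \<longlonglongrightarrow> g x"
  shows "lpnorm \<mu> p g \<le> ennreal L"
proof (cases "p = \<infinity>")
  case True
  have "AE x in \<mu>. \<forall>m. cmod (f m x) \<le> L"
    using L f by (simp add: AE_all_countable lpnorm_le_iff_infinity[OF True])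
  with lim have "AE x in \<mu>. cmod (g x) \<le> L"
  proof eventually_elim
    case (elim x)
    then show ?case by (intro LIMSEQ_le_const2[OF tendsto_norm]) auto
  qed
  then show ?thesis using g L by (simp add: lpnorm_le_iff_infinity[OF True])
next
  case False
  define q where "q = enn2real p"
  have q: "1 \<le> q" using enn2real_ge_1 p False by (simp add: q_def)
  have "(\<integral>\<^sup>+ x. ennreal (cmod (g x) powr q) \<partial>\<mu>)
      = (\<integral>\<^sup>+ x. liminf (\<lambda>m. ennreal (cmod (f m x) powr q)) \<partial>\<mu>)"
  proof (rule nn_integral_cong_AE, use lim in eventually_elim)
    case (elim x)
    then have "(\<lambda>m. ennreal (cmod (f m x) powr q)) \<longlonglongrightarrow> ennreal (cmod (g x) powr q)"
      using q by (intro tendsto_ennrealI tendsto_powr' tendsto_norm) auto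
    then show ?case by (intro lim_imp_Liminf[symmetric]) auto
  qed
  also have "\<dots> \<le> liminf (\<lambda>m. \<integral>\<^sup>+ x. ennreal (cmod (f m x) powr q) \<partial>\<mu>)"
    using f by (intro nn_integral_liminf) auto
  also have "\<dots> \<le> ennreal (L powr q)"
    using L by (intro Liminf_le always_eventually) (auto simp: q_def lpnorm_le_iff[OF p False])
  finally show ?thesis using L by (simp add: lpnorm_le_iff[OF p False] q_def)
qed

lemma lpnorm_eq_0_imp_AE:
  assumes p: "1 \<le> p" and f: "f \<in> borel_measurable \<mu>" and "lpnorm \<mu> p f = 0"
  shows "AE x in \<mu>. f x = 0"
proof (cases "p = \<infinity>")
  case True
  then show ?thesis using lpnorm_le_iff_infinity[OF True f, of 0] assms(3) by simp
next
  case False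
  then have "(\<integral>\<^sup>+ x. ennreal (cmod (f x) powr enn2real p) \<partial>\<mu>) = 0"
    using lpnorm_le_iff[OF p False, of 0 \<mu> f] assms(3) by simp
  then have "AE x in \<mu>. ennreal (cmod (f x) powr enn2real p) = 0"
    using f by (subst (asm) nn_integral_0_iff_AE) auto
  then show ?thesis by eventually_elim (simp add: ennreal_eq_0_iff)
qed

lemma lpnorm_compose:
  assumes p: "1 \<le> p" and T: "T \<in> measurable \<mu> \<mu>" and "distr \<mu> \<mu> T = \<mu>"
    and f: "f \<in> borel_measurable \<mu>" and "0 \<le> L" "lpnorm \<mu> p f \<le> ennreal L"
  shows "lpnorm \<mu> p (\<lambda>x. f (T x)) \<le> ennreal L"
proof (cases "p = \<infinity>")
  case True
  have "AE x in distr \<mu> \<mu> T. cmod (f x) \<le> L"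
    using assms lpnorm_le_iff_infinity[OF True f] by metis
  then have "AE x in \<mu>. cmod (f (T x)) \<le> L"
    using AE_distrD[OF T] by blast
  then show ?thesis using assms measurable_compose[OF T f] by (simp add: lpnorm_le_iff_infinity[OF True])
next
  case False
  have "(\<integral>\<^sup>+ x. ennreal (cmod (f (T x)) powr enn2real p) \<partial>\<mu>)
      = (\<integral>\<^sup>+ x. ennreal (cmod (f x) powr enn2real p) \<partial>distr \<mu> \<mu> T)"
    using T f by (subst nn_integral_distr) auto
  then show ?thesis using assms by (simp add: lpnorm_le_iff[OF p False])
qed

section \<open>One-parameter groups of rotations\<close>

lemma mpow_mult_vec: "mpow X k *v u = ((*v) X ^^ k) u"
  by (induction k) (simp_all flip: matrix_vector_mul_assoc)

lemma mpow_scaleR: "mpow (s *\<^sub>R X) k = s ^ k *\<^sub>R mpow X k"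
  by (induction k) (simp_all add: matrix_matrix_mult_def vec_eq_iff sum_distrib_left mult_ac)

text \<open>Coordinate \<open>i\<close> of exp(zX)u at complex time z. Using the iterates of
  \<open>X\<close> on \<open>u\<close> keeps the matrices real and turns differentiation in z into
  replacing u by Xu.\<close>

definition flow_coord :: "'n::finite mat \<Rightarrow> real^'n \<Rightarrow> 'n \<Rightarrow> complex \<Rightarrow> complex" where
  "flow_coord X u i z = (\<Sum>k. of_real ((((*v) X ^^ k) u) $ i / fact k) * z ^ k)"

lemma flow_coord_summable:
  fixes X :: "'n::finite mat"
  shows "summable (\<lambda>k. complex_of_real ((((*v) X ^^ k) u) $ i / fact k) * z ^ k)"
proof -
  obtain B where B: "0 \<le> B" "\<And>u. norm (X *v u) \<le> norm u * B"
    using bounded_linear.nonneg_bounded[OF matrix_vector_mul_bounded_linear[of X]] by blast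
  have pw: "norm (((*v) X ^^ k) u) \<le> norm u * B ^ k" for k
  proof (induction k)
    case (Suc k)
    have "norm (((*v) X ^^ Suc k) u) \<le> norm (((*v) X ^^ k) u) * B"
      using B(2)[of "((*v) X ^^ k) u"] by simp
    also have "\<dots> \<le> norm u * B ^ k * B" using Suc B by (intro mult_right_mono) auto
    finally show ?case by (simp add: mult_ac)
  qed simp
  show ?thesis
  proof (rule summable_comparison_test')
    show "summable (\<lambda>k. norm u * (inverse (fact k) * (B * cmod z) ^ k))"
      by (intro summable_mult summable_exp)
    fix k
    have "\<bar>(((*v) X ^^ k) u) $ i\<bar> \<le> norm u * B ^ k"
      using component_le_norm_cart pw order_trans by blast
    then have "\<bar>(((*v) X ^^ k) u) $ i\<bar> / fact k * cmod z ^ k \<le> norm u * B ^ k / fact k * cmod z ^ k"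
      by (intro mult_right_mono divide_right_mono) auto
    then show "norm (complex_of_real ((((*v) X ^^ k) u) $ i / fact k) * z ^ k)
       \<le> norm u * (inverse (fact k) * (B * cmod z) ^ k)"
      by (simp add: norm_mult norm_power norm_divide power_mult_distrib field_simps)
  qed
qed

lemma sums_flow_coord:
  "(\<lambda>k. complex_of_real ((((*v) X ^^ k) u) $ i / fact k) * z ^ k) sums flow_coord X u i z"
  unfolding flow_coord_def by (rule summable_sums[OF flow_coord_summable])

lemma flow_coord_0: "flow_coord X u i 0 = of_real (u $ i)"
  unfolding flow_coord_def using powser_zero[of "\<lambda>k. complex_of_real ((((*v) X ^^ k) u) $ i / fact k)"] by simp

lemma flow_coord_has_derivative:
  "(flow_coord X u i has_field_derivative flow_coord X (X *v u) i z) (at z)"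
proof -
  have "diffs (\<lambda>k. complex_of_real ((((*v) X ^^ k) u) $ i / fact k))
      = (\<lambda>k. of_real ((((*v) X ^^ k) (X *v u)) $ i / fact k))"
    by (rule ext) (simp add: diffs_def funpow_Suc_right del: funpow.simps of_nat_Suc)
  then show ?thesis
    using termdiffs_strong_converges_everywhere[OF flow_coord_summable[of X u i], of z]
    by (simp add: flow_coord_def[abs_def])
qed

text \<open>Entry (i, j) of the k-th power is coordinate i of the k-th iterate on a basis vector, so
  convergence is inherited from \<open>flow_coord_summable\<close>.\<close>

lemma mexp_sums: "(\<lambda>k. (1 / fact k) *\<^sub>R mpow X k) sums mexp X"
proof -
  have entry: "mpow X k $ i $ j = (((*v) X ^^ k) (axis j 1)) $ i" for i j k
    by (simp add: mpow_mult_vec[symmetric] matrix_vector_mul_component inner_axis)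
  have "summable (\<lambda>k. (1 / fact k) * mpow X k $ i $ j)" for i j
  proof -
    have "summable (\<lambda>k. Re (complex_of_real ((((*v) X ^^ k) (axis j 1)) $ i / fact k) * 1 ^ k))"
      by (intro summable_Re flow_coord_summable)
    then have "summable (\<lambda>k. (((*v) X ^^ k) (axis j 1)) $ i / fact k)"
      by (simp only: power_one mult_1_right Re_complex_of_real)
    then show ?thesis by (simp add: entry)
  qed
  then have "(\<lambda>k. (1 / fact k) *\<^sub>R mpow X k) sums (\<chi> i j. \<Sum>k. (1 / fact k) * mpow X k $ i $ j)"
    unfolding sums_def by (intro vec_tendstoI) (auto dest: summable_LIMSEQ)
  then show ?thesis unfolding mexp_def by (rule summable_sums[OF sums_summable])
qed

lemma flow_coord_of_real: "flow_coord X u i (of_real s) = of_real ((mexp (s *\<^sub>R X) *v u) $ i)"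
proof -
  have "linear (\<lambda>A. (A *v u) $ i)"
    by (intro linearI)
       (simp_all add: matrix_vector_mult_add_rdistrib scaleR_matrix_vector_assoc[symmetric])
  then have "bounded_linear (\<lambda>A. (A *v u) $ i)" by (simp add: linear_conv_bounded_linear)
  from bounded_linear.sums[OF this mexp_sums]
  have "(\<lambda>k. (((1 / fact k) *\<^sub>R mpow (s *\<^sub>R X) k) *v u) $ i) sums ((mexp (s *\<^sub>R X) *v u) $ i)" .
  then have "(\<lambda>k. complex_of_real ((((1 / fact k) *\<^sub>R mpow (s *\<^sub>R X) k) *v u) $ i))
      sums of_real ((mexp (s *\<^sub>R X) *v u) $ i)"
    by (subst sums_of_real_iff)
  then have "(\<lambda>k. complex_of_real ((((*v) X ^^ k) u) $ i / fact k) * of_real s ^ k)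
      sums of_real ((mexp (s *\<^sub>R X) *v u) $ i)"
    by (simp add: mpow_scaleR scaleR_matrix_vector_assoc[symmetric] mpow_mult_vec mult_ac)
  then show ?thesis using sums_flow_coord sums_unique2 by blast
qed

lemma mexp_0_mult_vec: "mexp (0 *\<^sub>R X) *v u = u"
proof -
  have "complex_of_real ((mexp (0 *\<^sub>R X) *v u) $ i) = of_real (u $ i)" for i
    using flow_coord_of_real[of X u i 0] by (simp add: flow_coord_0)
  then show ?thesis by (simp add: vec_eq_iff)
qed

section \<open>Skew-symmetry and contractivity of generators of rotations\<close>

lemma norm_orthogonal_matrix_mult_vec:
  fixes A :: "real^'n::finite^'n"
  assumes "orthogonal_matrix A"
  shows "norm (A *v u) = norm u"
  using assms orthogonal_transformation_matrix[of "(*v) A"]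
  by (simp add: orthogonal_transformation)

text \<open>The squared length of exp(sX)u is constant in s; its derivative at s = 0 is twice this
  inner product.\<close>

lemma inner_generator_eq_0:
  fixes X :: "'n::finite mat"
  assumes orth: "\<And>s. orthogonal_matrix (mexp (s *\<^sub>R X))"
  shows "u \<bullet> (X *v u) = 0"
proof -
  define q where "q s = (\<Sum>i\<in>UNIV. (mexp (s *\<^sub>R X) *v u) $ i * (mexp (s *\<^sub>R X) *v u) $ i)" for s
  have coord: "((\<lambda>s. (mexp (s *\<^sub>R X) *v u) $ i) has_field_derivative (X *v u) $ i) (at 0)" for i
  proof -
    have "((\<lambda>s. flow_coord X u i (of_real s)) has_vector_derivative flow_coord X (X *v u) i 0) (at 0)"
      using flow_coord_has_derivative[of X u i 0]
      by (intro has_vector_derivative_real_field[of _ _ _ UNIV, simplified]) auto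
    then have "((\<lambda>s. Re (flow_coord X u i (of_real s))) has_vector_derivative Re (flow_coord X (X *v u) i 0)) (at 0)"
      by (rule bounded_linear.has_vector_derivative[OF bounded_linear_Re])
    then show ?thesis
      by (simp add: flow_coord_of_real flow_coord_0 has_real_derivative_iff_has_vector_derivative)
  qed
  have "(q has_field_derivative (\<Sum>i\<in>UNIV. 2 * (u $ i * (X *v u) $ i))) (at 0)"
    unfolding q_def
    using mexp_0_mult_vec[of X u]
    by (auto intro!: derivative_eq_intros coord sum.cong simp del: scale_zero_left scaleR_zero_left)
  moreover have "q = (\<lambda>s. u \<bullet> u)"
  proof
    fix s
    have "q s = (norm (mexp (s *\<^sub>R X) *v u))\<^sup>2"
      by (simp add: q_def power2_norm_eq_inner inner_vec_def)
    then show "q s = u \<bullet> u" by (simp add: norm_orthogonal_matrix_mult_vec orth power2_norm_eq_inner)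
  qed
  ultimately have "(\<Sum>i\<in>UNIV. 2 * (u $ i * (X *v u) $ i)) = 0"
    using DERIV_unique DERIV_const by metis
  then show ?thesis by (simp add: inner_vec_def flip: sum_distrib_left)
qed

lemma generator_skew:
  fixes X :: "'n::finite mat"
  assumes orth: "\<And>s. orthogonal_matrix (mexp (s *\<^sub>R X))"
  shows "w \<bullet> (X *v u) = - (u \<bullet> (X *v w))"
  using inner_generator_eq_0[OF orth, of "u + w"] inner_generator_eq_0[OF orth, of u]
    inner_generator_eq_0[OF orth, of w]
  by (simp add: matrix_vector_right_distrib inner_add_left inner_add_right)

text \<open>The gain over the Hilbert-Schmidt bound sqrt 2 comes from Cauchy-Schwarz against a skew
  test matrix: with w = Xu orthogonal to u one has X . X = 2, X . B = 2|w|^2 and B . B =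
  2|w|^2|u|^2, hence |w|^4 <= |w|^2|u|^2.\<close>

lemma unit_generator_contractive:
  fixes X :: "'n::finite mat"
  assumes orth: "\<And>s. orthogonal_matrix (mexp (s *\<^sub>R X))" and unit: "lie_inner X X = 1"
  shows "norm (X *v u) \<le> norm u"
proof -
  define w where "w = X *v u"
  \<comment> \<open>Up to a factor, the infinitesimal rotation in the plane of \<open>u\<close> and
    \<open>w\<close>.\<close>
  define B :: "'n mat" where "B = (\<chi> i j. w $ i * u $ j - u $ i * w $ j)"
  have skew: "X $ i $ j = - X $ j $ i" for i j
    using generator_skew[OF orth, of "axis i 1" "axis j 1"]
    by (simp add: inner_axis' matrix_vector_mul_component inner_axis)
  have "trace (X ** X) = (\<Sum>i\<in>UNIV. \<Sum>j\<in>UNIV. X $ i $ j * X $ j $ i)"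
    by (simp add: trace_def matrix_matrix_mult_def)
  also have "\<dots> = (\<Sum>i\<in>UNIV. \<Sum>j\<in>UNIV. - (X $ i $ j * X $ i $ j))"
    by (intro sum.cong refl) (subst (2) skew, simp)
  also have "\<dots> = - (X \<bullet> X)" by (simp add: inner_vec_def sum_negf)
  finally have XX: "X \<bullet> X = 2" using unit by (simp add: lie_inner_def)
  have inner_outer: "(\<Sum>i\<in>UNIV. \<Sum>j\<in>UNIV. a $ i * X $ i $ j * b $ j) = a \<bullet> (X *v b)" for a b
    by (simp add: inner_vec_def matrix_vector_mult_def sum_distrib_left mult.assoc)
  have "X \<bullet> B = w \<bullet> (X *v u) - u \<bullet> (X *v w)"
    unfolding inner_outer[symmetric] B_def
    by (simp add: inner_vec_def algebra_simps sum_subtractf)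
  also have "\<dots> = 2 * (norm w)\<^sup>2"
    using generator_skew[OF orth, of w u] by (simp add: w_def power2_norm_eq_inner)
  finally have XB: "X \<bullet> B = 2 * (norm w)\<^sup>2" .
  have "B \<bullet> B = (\<Sum>i\<in>UNIV. \<Sum>j\<in>UNIV. (w $ i * w $ i) * (u $ j * u $ j) + (u $ i * u $ i) * (w $ j * w $ j)
      - 2 * ((w $ i * u $ i) * (w $ j * u $ j)))"
    by (simp add: B_def inner_vec_def algebra_simps)
  also have "\<dots> = 2 * ((w \<bullet> w) * (u \<bullet> u)) - 2 * ((w \<bullet> u) * (w \<bullet> u))"
    by (simp only: sum_subtractf sum.distrib inner_vec_def inner_real_def sum_distrib_left[symmetric] sum_distrib_right[symmetric]) simp
  also have "w \<bullet> u = 0" using inner_generator_eq_0[OF orth] by (simp add: w_def inner_commute)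
  finally have BB: "B \<bullet> B = 2 * ((norm w)\<^sup>2 * (norm u)\<^sup>2)" by (simp add: power2_norm_eq_inner)
  have "(2 * (norm w)\<^sup>2)\<^sup>2 \<le> 2 * (2 * ((norm w)\<^sup>2 * (norm u)\<^sup>2))"
    using Cauchy_Schwarz_ineq[of X B] by (simp add: XB XX BB)
  then have "(norm w)\<^sup>2 * (norm w)\<^sup>2 \<le> (norm w)\<^sup>2 * (norm u)\<^sup>2"
    by (simp add: power2_eq_square)
  from mult_left_le_imp_le[OF this] have "(norm w)\<^sup>2 \<le> (norm u)\<^sup>2" if "w \<noteq> 0"
    using that by simp
  then have "norm w \<le> norm u" using power2_le_imp_le[of "norm w" "norm u"] by (cases "w = 0") auto
  then show ?thesis by (simp add: w_def)
qed

text \<open>Taylor expansion about Re z: the k-th derivative there is a coordinate of a rotated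
  vector X^k u, of length at most |u|, and the increment i Im z has modulus |Im z|. Summation gives
  the exponential.\<close>

lemma norm_flow_coord_le:
  fixes X :: "'n::finite mat"
  assumes orth: "\<And>s. orthogonal_matrix (mexp (s *\<^sub>R X))"
    and contr: "\<And>u. norm (X *v u) \<le> norm u"
  shows "cmod (flow_coord X u i z) \<le> norm u * exp \<bar>Im z\<bar>"
proof -
  have pw: "norm (((*v) X ^^ k) u) \<le> norm u" for k
    by (induction k) (auto intro: order_trans[OF contr])
  have der: "(deriv ^^ k) (flow_coord X u i) = flow_coord X (((*v) X ^^ k) u) i" for k
    by (induction k) (auto intro!: DERIV_imp_deriv flow_coord_has_derivative)
  have hol: "flow_coord X u i holomorphic_on ball (of_real (Re z)) (\<bar>Im z\<bar> + 1)"
    by (rule holomorphic_on_subset[of _ UNIV])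
       (auto simp: holomorphic_on_open intro!: exI flow_coord_has_derivative)
  have z: "z - of_real (Re z) = \<i> * of_real (Im z)" by (simp add: complex_eq_iff)
  have "(\<lambda>k. (deriv ^^ k) (flow_coord X u i) (of_real (Re z)) / fact k * (z - of_real (Re z)) ^ k)
      sums flow_coord X u i z"
    by (rule holomorphic_power_series[OF hol]) (simp add: dist_norm norm_minus_commute z norm_mult)
  moreover have "cmod ((deriv ^^ k) (flow_coord X u i) (of_real (Re z)) / fact k * (z - of_real (Re z)) ^ k)
      \<le> norm u * (inverse (fact k) * \<bar>Im z\<bar> ^ k)" for k
  proof -
    have "cmod (flow_coord X (((*v) X ^^ k) u) i (of_real (Re z))) \<le> norm (mexp (Re z *\<^sub>R X) *v (((*v) X ^^ k) u))"
      by (simp add: flow_coord_of_real component_le_norm_cart)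
    also have "\<dots> \<le> norm u" by (simp add: norm_orthogonal_matrix_mult_vec orth pw)
    finally show ?thesis
      by (simp add: der z norm_mult norm_power norm_divide norm_inverse divide_inverse mult.assoc mult_right_mono)
  qed
  moreover have "(\<lambda>k. norm u * (inverse (fact k) * \<bar>Im z\<bar> ^ k)) sums (norm u * exp \<bar>Im z\<bar>)"
    using exp_converges[of "\<bar>Im z\<bar>"] by (intro sums_mult) (simp add: divide_inverse mult.commute)
  ultimately show ?thesis using norm_sums_le by blast
qed

section \<open>Lie derivatives of polynomials\<close>

text \<open>The index is an upper bound for the degree. The closure rules are those under which
  entire extensions and their growth exponents combine, which allows rule induction in place of work
  with coefficient families.\<close>

inductive pol :: "nat \<Rightarrow> (real^'n::finite \<Rightarrow> complex) \<Rightarrow> bool" where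
  const: "pol n (\<lambda>x. c)"
| coord: "pol (Suc n) (\<lambda>x. of_real (x $ i))"
| add: "pol n f \<Longrightarrow> pol n g \<Longrightarrow> pol n (\<lambda>x. f x + g x)"
| mult: "pol m f \<Longrightarrow> pol n g \<Longrightarrow> pol (m + n) (\<lambda>x. f x * g x)"

lemma pol_mono: "pol m f \<Longrightarrow> m \<le> n \<Longrightarrow> pol n f"
  using pol.mult[OF _ pol.const[of "n - m" 1], of m f] by simp

lemma pol_sum: "(\<And>i. i \<in> I \<Longrightarrow> pol n (f i)) \<Longrightarrow> pol n (\<lambda>x. \<Sum>i\<in>I. f i x)"
  by (induction I rule: infinite_finite_induct) (auto intro: pol.const pol.add)

lemma pol_coord_power: "pol k (\<lambda>x. of_real (x $ i) ^ k)"
proof (induction k)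
  case (Suc k)
  show ?case using pol.mult[OF pol.coord[of 0 i] Suc] by simp
qed (simp add: pol.const)

lemma pol_monomial: "finite I \<Longrightarrow> pol (\<Sum>i\<in>I. a i) (\<lambda>x. \<Prod>i\<in>I. of_real (x $ i) ^ a i)"
proof (induction I rule: finite_induct)
  case (insert i I)
  then show ?case using pol.mult[OF pol_coord_power[of "a i" i] insert.IH] by simp
qed (simp add: pol.const)

lemma poly_deg_le_imp_pol:
  fixes P :: "real^'n::finite \<Rightarrow> complex"
  assumes "poly_deg_le n P"
  shows "pol n P"
proof -
  obtain c :: "('n \<Rightarrow> nat) \<Rightarrow> complex" where c: "\<And>a. c a \<noteq> 0 \<Longrightarrow> (\<Sum>i\<in>UNIV. a i) \<le> n"
    and P: "P = (\<lambda>x. \<Sum>a\<in>{a. c a \<noteq> 0}. c a * (\<Prod>i\<in>UNIV. of_real (x $ i) ^ a i))"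
    using assms unfolding poly_deg_le_def by auto
  have "pol n (\<lambda>x::real^'n. c a * (\<Prod>i\<in>UNIV. of_real (x $ i) ^ a i))" if "c a \<noteq> 0" for a
    using pol_mono[OF pol.mult[OF pol.const[of 0 "c a"] pol_monomial[of UNIV a]], of n] c[OF that]
    by simp
  then show ?thesis unfolding P by (intro pol_sum) auto
qed

lemma continuous_on_pol: "pol n f \<Longrightarrow> continuous_on UNIV f"
  by (induction rule: pol.induct) (auto intro!: continuous_intros)

text \<open>F extends s \<mapsto> f(exp(sX)x) to complex s. One constant C serves all x in the unit ball.\<close>

definition lie_derivative :: "'n::finite mat \<Rightarrow> nat \<Rightarrow> (real^'n \<Rightarrow> complex) \<Rightarrow> (real^'n \<Rightarrow> complex) \<Rightarrow> bool" where
  "lie_derivative X n f g \<longleftrightarrow> pol n f \<and> pol n g \<and> (\<exists>C\<ge>0. \<forall>x. \<exists>F. F holomorphic_on UNIV \<and>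
     (\<forall>s. F (of_real s) = f (mexp (s *\<^sub>R X) *v x)) \<and> deriv F 0 = g x \<and>
     (norm x \<le> 1 \<longrightarrow> (\<forall>z. cmod (F z) \<le> C * exp (real n * \<bar>Im z\<bar>))))"

text \<open>\<open>X\<close> maps coordinates to linear forms and differentiation obeys Leibniz's
  rule, so the degree does not rise. Bounds add for sums; for products they multiply while the
  growth exponents add.\<close>

lemma pol_has_lie_derivative:
  fixes X :: "'n::finite mat"
  assumes orth: "\<And>s. orthogonal_matrix (mexp (s *\<^sub>R X))"
    and contr: "\<And>u. norm (X *v u) \<le> norm u"
    and "pol n f"
  shows "\<exists>g. lie_derivative X n f g"
  using assms(3)
proof (induction rule: pol.induct)
  case (const n c)
  have "\<exists>F. F holomorphic_on UNIV \<and>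
     (\<forall>s. F (of_real s) = c) \<and> deriv F 0 = 0 \<and>
     (norm x \<le> 1 \<longrightarrow> (\<forall>z. cmod (F z) \<le> cmod c * exp (real n * \<bar>Im z\<bar>)))" for x :: "real^'n"
    by (intro exI[of _ "\<lambda>_. c"]) (auto intro: order_trans[OF _ mult_left_mono[of 1]])
  then have "lie_derivative X n (\<lambda>x. c) (\<lambda>x. 0)"
    unfolding lie_derivative_def by (auto intro!: pol.const exI[of _ "cmod c"])
  then show ?case by blast
next
  case (coord n i)
  have "pol (Suc n) (\<lambda>x. of_real ((X *v x) $ i))"
    using pol_mono[OF pol.mult[OF pol.const pol.coord[of 0]], of 0 "Suc n"]
    by (auto simp: matrix_vector_mult_def intro!: pol_sum)
  moreover have "\<exists>F. F holomorphic_on UNIV \<and>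
     (\<forall>s. F (of_real s) = of_real ((mexp (s *\<^sub>R X) *v x) $ i)) \<and> deriv F 0 = of_real ((X *v x) $ i) \<and>
     (norm x \<le> 1 \<longrightarrow> (\<forall>z. cmod (F z) \<le> 1 * exp (real (Suc n) * \<bar>Im z\<bar>)))" for x
  proof (intro exI[of _ "flow_coord X x i"] conjI allI impI)
    show "flow_coord X x i holomorphic_on UNIV"
      by (auto simp: holomorphic_on_open intro!: exI flow_coord_has_derivative)
    show "deriv (flow_coord X x i) 0 = of_real ((X *v x) $ i)"
      by (subst DERIV_imp_deriv[OF flow_coord_has_derivative]) (rule flow_coord_0)
  next
    fix z assume "norm x \<le> 1"
    have "cmod (flow_coord X x i z) \<le> norm x * exp \<bar>Im z\<bar>"
      by (rule norm_flow_coord_le[OF orth contr])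
    also have "\<dots> \<le> 1 * exp (real (Suc n) * \<bar>Im z\<bar>)"
      using \<open>norm x \<le> 1\<close> by (intro mult_mono) (auto simp: algebra_simps)
    finally show "cmod (flow_coord X x i z) \<le> 1 * exp (real (Suc n) * \<bar>Im z\<bar>)" .
  qed (rule flow_coord_of_real)
  ultimately have "lie_derivative X (Suc n) (\<lambda>x. of_real (x $ i)) (\<lambda>x. of_real ((X *v x) $ i))"
    unfolding lie_derivative_def by (intro conjI pol.coord exI[of _ 1]) auto
  then show ?case by blast
next
  case (add n f1 f2)
  then obtain g1 g2 where "lie_derivative X n f1 g1" "lie_derivative X n f2 g2" by blast
  then obtain C1 C2 where g: "pol n g1" "pol n g2" and C: "0 \<le> C1" "0 \<le> C2" and
    F1: "\<And>x. \<exists>F. F holomorphic_on UNIV \<and> (\<forall>s. F (of_real s) = f1 (mexp (s *\<^sub>R X) *v x)) \<and> deriv F 0 = g1 x \<and>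
     (norm x \<le> 1 \<longrightarrow> (\<forall>z. cmod (F z) \<le> C1 * exp (real n * \<bar>Im z\<bar>)))" and
    F2: "\<And>x. \<exists>F. F holomorphic_on UNIV \<and> (\<forall>s. F (of_real s) = f2 (mexp (s *\<^sub>R X) *v x)) \<and> deriv F 0 = g2 x \<and>
     (norm x \<le> 1 \<longrightarrow> (\<forall>z. cmod (F z) \<le> C2 * exp (real n * \<bar>Im z\<bar>)))"
    unfolding lie_derivative_def by blast
  have "\<exists>F. F holomorphic_on UNIV \<and>
     (\<forall>s. F (of_real s) = f1 (mexp (s *\<^sub>R X) *v x) + f2 (mexp (s *\<^sub>R X) *v x)) \<and> deriv F 0 = g1 x + g2 x \<and>
     (norm x \<le> 1 \<longrightarrow> (\<forall>z. cmod (F z) \<le> (C1 + C2) * exp (real n * \<bar>Im z\<bar>)))" for x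
  proof -
    obtain F where F: "F holomorphic_on UNIV" "\<And>s. F (of_real s) = f1 (mexp (s *\<^sub>R X) *v x)" "deriv F 0 = g1 x"
      "norm x \<le> 1 \<Longrightarrow> \<forall>z. cmod (F z) \<le> C1 * exp (real n * \<bar>Im z\<bar>)" using F1 by meson
    obtain H where H: "H holomorphic_on UNIV" "\<And>s. H (of_real s) = f2 (mexp (s *\<^sub>R X) *v x)" "deriv H 0 = g2 x"
      "norm x \<le> 1 \<Longrightarrow> \<forall>z. cmod (H z) \<le> C2 * exp (real n * \<bar>Im z\<bar>)" using F2 by meson
    show ?thesis
    proof (intro exI[of _ "\<lambda>z. F z + H z"] conjI allI impI)
      show "(\<lambda>z. F z + H z) holomorphic_on UNIV" using F(1) H(1) by (intro holomorphic_intros)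
      show "deriv (\<lambda>z. F z + H z) 0 = g1 x + g2 x"
        using F(1,3) H(1,3) by (subst deriv_add) (auto simp: holomorphic_on_imp_differentiable_at)
    next
      fix z assume "norm x \<le> 1"
      then have "cmod (F z) + cmod (H z) \<le> (C1 + C2) * exp (real n * \<bar>Im z\<bar>)"
        using F(4) H(4) by (simp add: distrib_right add_mono)
      then show "cmod (F z + H z) \<le> (C1 + C2) * exp (real n * \<bar>Im z\<bar>)"
        by (rule order_trans[OF norm_triangle_ineq])
    qed (simp add: F H)
  qed
  then have "lie_derivative X n (\<lambda>x. f1 x + f2 x) (\<lambda>x. g1 x + g2 x)"
    unfolding lie_derivative_def using C g add.hyps
    by (intro conjI pol.add exI[of _ "C1 + C2"]) auto
  then show ?case by blast
next
  case (mult m f1 n f2)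
  then obtain g1 g2 where "lie_derivative X m f1 g1" "lie_derivative X n f2 g2" by blast
  then obtain C1 C2 where g: "pol m g1" "pol n g2" and C: "0 \<le> C1" "0 \<le> C2" and
    F1: "\<And>x. \<exists>F. F holomorphic_on UNIV \<and> (\<forall>s. F (of_real s) = f1 (mexp (s *\<^sub>R X) *v x)) \<and> deriv F 0 = g1 x \<and>
     (norm x \<le> 1 \<longrightarrow> (\<forall>z. cmod (F z) \<le> C1 * exp (real m * \<bar>Im z\<bar>)))" and
    F2: "\<And>x. \<exists>F. F holomorphic_on UNIV \<and> (\<forall>s. F (of_real s) = f2 (mexp (s *\<^sub>R X) *v x)) \<and> deriv F 0 = g2 x \<and>
     (norm x \<le> 1 \<longrightarrow> (\<forall>z. cmod (F z) \<le> C2 * exp (real n * \<bar>Im z\<bar>)))"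
    unfolding lie_derivative_def by blast
  have "\<exists>F. F holomorphic_on UNIV \<and>
     (\<forall>s. F (of_real s) = f1 (mexp (s *\<^sub>R X) *v x) * f2 (mexp (s *\<^sub>R X) *v x)) \<and>
     deriv F 0 = f1 x * g2 x + g1 x * f2 x \<and>
     (norm x \<le> 1 \<longrightarrow> (\<forall>z. cmod (F z) \<le> (C1 * C2) * exp (real (m + n) * \<bar>Im z\<bar>)))" for x
  proof -
    obtain F where F: "F holomorphic_on UNIV" "\<And>s. F (of_real s) = f1 (mexp (s *\<^sub>R X) *v x)" "deriv F 0 = g1 x"
      "norm x \<le> 1 \<Longrightarrow> \<forall>z. cmod (F z) \<le> C1 * exp (real m * \<bar>Im z\<bar>)" using F1 by meson
    obtain H where H: "H holomorphic_on UNIV" "\<And>s. H (of_real s) = f2 (mexp (s *\<^sub>R X) *v x)" "deriv H 0 = g2 x"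
      "norm x \<le> 1 \<Longrightarrow> \<forall>z. cmod (H z) \<le> C2 * exp (real n * \<bar>Im z\<bar>)" using F2 by meson
    have at0: "F 0 = f1 x" "H 0 = f2 x"
      using F(2)[of 0] H(2)[of 0] mexp_0_mult_vec[of X x] by simp_all
    show ?thesis
    proof (intro exI[of _ "\<lambda>z. F z * H z"] conjI allI impI)
      show "(\<lambda>z. F z * H z) holomorphic_on UNIV" using F(1) H(1) by (intro holomorphic_intros)
      show "deriv (\<lambda>z. F z * H z) 0 = f1 x * g2 x + g1 x * f2 x"
        using F(1,3) H(1,3) at0
        by (subst deriv_mult) (auto simp: holomorphic_on_imp_differentiable_at)
    next
      fix z assume "norm x \<le> 1"
      then have "cmod (F z) * cmod (H z) \<le> (C1 * exp (real m * \<bar>Im z\<bar>)) * (C2 * exp (real n * \<bar>Im z\<bar>))"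
        using F(4) H(4) C by (intro mult_mono) auto
      also have "\<dots> = (C1 * C2) * exp (real (m + n) * \<bar>Im z\<bar>)"
        by (simp add: distrib_right exp_add)
      finally show "cmod (F z * H z) \<le> (C1 * C2) * exp (real (m + n) * \<bar>Im z\<bar>)"
        by (simp add: norm_mult)
    qed (simp add: F H)
  qed
  then have "lie_derivative X (m + n) (\<lambda>x. f1 x * f2 x) (\<lambda>x. f1 x * g2 x + g1 x * f2 x)"
    unfolding lie_derivative_def using C g mult.hyps
    by (intro conjI pol.mult pol.add exI[of _ "C1 * C2"]) auto
  then show ?case by blast
qed

section \<open>Uniform bounds, difference quotients and interpolation along orbits\<close>

lemma lie_derivative_extension:
  assumes "lie_derivative X n f g"
  obtains C where "0 \<le> C" "\<And>x. norm x \<le> 1 \<Longrightarrow> \<exists>F. F holomorphic_on UNIV \<and>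
     (\<forall>s. F (of_real s) = f (mexp (s *\<^sub>R X) *v x)) \<and> deriv F 0 = g x \<and>
     (\<forall>z. cmod (F z) \<le> C * exp (real n * \<bar>Im z\<bar>))"
proof -
  obtain C where "0 \<le> C" and C: "\<forall>x. \<exists>F. F holomorphic_on UNIV \<and>
     (\<forall>s. F (of_real s) = f (mexp (s *\<^sub>R X) *v x)) \<and> deriv F 0 = g x \<and>
     (norm x \<le> 1 \<longrightarrow> (\<forall>z. cmod (F z) \<le> C * exp (real n * \<bar>Im z\<bar>)))"
    using assms unfolding lie_derivative_def by (elim exE conjE)
  show ?thesis
  proof (rule that[OF \<open>0 \<le> C\<close>])
    fix x :: "real^'a" assume "norm x \<le> 1"
    then show "\<exists>F. F holomorphic_on UNIV \<and>
     (\<forall>s. F (of_real s) = f (mexp (s *\<^sub>R X) *v x)) \<and> deriv F 0 = g x \<and>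
     (\<forall>z. cmod (F z) \<le> C * exp (real n * \<bar>Im z\<bar>))"
      using C[rule_format, of x] by simp
  qed
qed

lemma lie_derivative_bounded:
  assumes "lie_derivative X n f g"
  obtains B where "0 \<le> B" "\<And>x. norm x \<le> 1 \<Longrightarrow> cmod (f x) \<le> B"
proof -
  obtain C where C: "0 \<le> C" "\<And>x. norm x \<le> 1 \<Longrightarrow> \<exists>F. F holomorphic_on UNIV \<and>
     (\<forall>s. F (of_real s) = f (mexp (s *\<^sub>R X) *v x)) \<and> deriv F 0 = g x \<and>
     (\<forall>z. cmod (F z) \<le> C * exp (real n * \<bar>Im z\<bar>))"
    by (rule lie_derivative_extension[OF assms]) (rule that)
  have "cmod (f x) \<le> C" if x: "norm x \<le> 1" for x
  proof -
    obtain F where F: "\<And>s. F (of_real s) = f (mexp (s *\<^sub>R X) *v x)"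
      "\<And>z. cmod (F z) \<le> C * exp (real n * \<bar>Im z\<bar>)" using C(2)[OF x] by blast
    show ?thesis using F(1)[of 0] F(2)[of 0] mexp_0_mult_vec[of X x] by simp
  qed
  with C(1) show ?thesis using that by blast
qed

lemma lie_derivative_difference_quotient:
  assumes "lie_derivative X n f g"
  obtains B where "0 \<le> B"
    "\<And>x t. norm x \<le> 1 \<Longrightarrow> t \<noteq> 0 \<Longrightarrow> \<bar>t\<bar> \<le> 1 \<Longrightarrow>
      cmod ((f (mexp (t *\<^sub>R X) *v x) - f x) / of_real t - g x) \<le> B * \<bar>t\<bar>"
proof -
  obtain C where C: "0 \<le> C" "\<And>x. norm x \<le> 1 \<Longrightarrow> \<exists>F. F holomorphic_on UNIV \<and>
     (\<forall>s. F (of_real s) = f (mexp (s *\<^sub>R X) *v x)) \<and> deriv F 0 = g x \<and>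
     (\<forall>z. cmod (F z) \<le> C * exp (real n * \<bar>Im z\<bar>))"
    by (rule lie_derivative_extension[OF assms]) (rule that)
  \<comment> \<open>Cauchy's bound for the second derivative on the unit disc: factor 2!, circles of
    radius 1, hence points of modulus at most 2. It does not depend on x because \<open>C\<close>
    does not.\<close>
  define B where "B = 2 * (C * exp (real n * 2))"
  have "cmod ((f (mexp (t *\<^sub>R X) *v x) - f x) / of_real t - g x) \<le> B * \<bar>t\<bar>"
    if x: "norm x \<le> 1" and t: "t \<noteq> 0" "\<bar>t\<bar> \<le> 1" for x t
  proof -
    obtain F where F: "F holomorphic_on UNIV" "\<And>s. F (of_real s) = f (mexp (s *\<^sub>R X) *v x)" "deriv F 0 = g x"
      "\<And>z. cmod (F z) \<le> C * exp (real n * \<bar>Im z\<bar>)" using C(2)[OF x] by blast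
    have "cmod ((deriv ^^ 0) F (of_real t) - (\<Sum>i\<le>1. (deriv ^^ i) F 0 * (of_real t - 0) ^ i / fact i))
        \<le> B * cmod (of_real t - 0) ^ Suc 1 / fact 1"
    proof (rule complex_Taylor[where S = "cball 0 1"])
      fix i z
      have "(deriv ^^ i) F holomorphic_on UNIV" using F(1) by (intro holomorphic_higher_deriv) auto
      then show "((deriv ^^ i) F has_field_derivative (deriv ^^ Suc i) F z) (at z within cball 0 1)"
        by (auto intro: has_field_derivative_at_within holomorphic_derivI[of _ UNIV])
    next
      fix z :: complex assume z: "z \<in> cball 0 1"
      have "cmod ((deriv ^^ Suc 1) F z) \<le> fact (Suc 1) * (C * exp (real n * 2)) / 1 ^ Suc 1"
      proof (rule Cauchy_inequality)
        fix w assume "cmod (z - w) = 1"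
        then have "cmod w \<le> 2" using z norm_triangle_ineq4[of z "z - w"] by (simp add: dist_norm)
        then have "\<bar>Im w\<bar> \<le> 2" using abs_Im_le_cmod[of w] by linarith
        then have "C * exp (real n * \<bar>Im w\<bar>) \<le> C * exp (real n * 2)"
          using C(1) by (intro mult_left_mono) (auto intro: mult_left_mono)
        then show "cmod (F w) \<le> C * exp (real n * 2)" using F(4)[of w] by linarith
      qed (use F(1) in \<open>auto intro: holomorphic_on_subset holomorphic_on_imp_continuous_on\<close>)
      then show "cmod ((deriv ^^ Suc 1) F z) \<le> B" by (simp add: B_def)
    qed (use t in auto)
    then have *: "cmod (f (mexp (t *\<^sub>R X) *v x) - f x - g x * of_real t) \<le> B * \<bar>t\<bar> * \<bar>t\<bar>"
      using F(2)[of 0] mexp_0_mult_vec[of X x] by (simp add: F(2,3) power2_eq_square diff_diff_eq)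
    have "(f (mexp (t *\<^sub>R X) *v x) - f x) / of_real t - g x
        = (f (mexp (t *\<^sub>R X) *v x) - f x - g x * of_real t) / of_real t"
      using t by (simp add: field_simps)
    also have "cmod \<dots> \<le> B * \<bar>t\<bar>" using * t by (simp add: norm_divide pos_divide_le_eq)
    finally show ?thesis .
  qed
  moreover have "0 \<le> B" using C(1) by (simp add: B_def)
  ultimately show ?thesis using that by blast
qed

text \<open>Rescaling time by 1/n brings the growth exponent to 1 and divides the derivative by n;
  multiplying back puts the factor n into the coefficients.\<close>

lemma lie_derivative_interpolation:
  assumes "lie_derivative X n f g" and x: "norm x \<le> 1" and n: "0 < n"
  shows "(\<lambda>m. \<Sum>k<m. (-1)^k * (f (mexp ((node k / n) *\<^sub>R X) *v x) - f (mexp ((- node k / n) *\<^sub>R X) *v x))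
            * of_real (n / (node k)\<^sup>2)) \<longlonglongrightarrow> g x"
proof -
  obtain C F where F: "F holomorphic_on UNIV" "\<And>s. F (of_real s) = f (mexp (s *\<^sub>R X) *v x)" "deriv F 0 = g x"
      "\<And>z. cmod (F z) \<le> C * exp (real n * \<bar>Im z\<bar>)"
    using lie_derivative_extension[OF assms(1)] x by metis
  define H where "H z = F (of_real (1 / n) * z)" for z
  have "(F \<circ> (\<lambda>z. of_real (1 / n) * z)) holomorphic_on UNIV"
    by (rule holomorphic_on_compose_gen[of _ _ _ UNIV]) (auto intro!: holomorphic_intros F)
  then have holH: "H holomorphic_on UNIV"
    by (simp add: H_def[abs_def] o_def)
  have dH: "deriv H 0 = g x / of_real n"
  proof -
    have "(F has_field_derivative g x) (at (of_real (1 / n) * 0))"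
      using holomorphic_derivI[OF F(1), of 0] F(3) by simp
    then have "(H has_field_derivative g x * of_real (1 / n)) (at 0)"
      unfolding H_def[abs_def] by (rule DERIV_chain2[OF _ DERIV_cmult_Id])
    then show ?thesis by (simp add: DERIV_imp_deriv)
  qed
  have "(\<lambda>m. \<Sum>k<m. (-1)^k * (H (of_real (node k)) - H (- of_real (node k))) / of_real ((node k)\<^sup>2))
      \<longlonglongrightarrow> deriv H 0"
  proof (rule exponential_type_interpolation[OF holH])
    fix z show "cmod (H z) \<le> C * exp \<bar>Im z\<bar>"
      using F(4)[of "of_real (1 / n) * z"] n by (simp add: H_def abs_mult)
  qed
  then have "(\<lambda>m. (\<Sum>k<m. (-1)^k * (H (of_real (node k)) - H (- of_real (node k))) / of_real ((node k)\<^sup>2)) * of_real n)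
      \<longlonglongrightarrow> deriv H 0 * of_real n"
    by (intro tendsto_intros)
  moreover have "H (of_real (node k)) = f (mexp ((node k / n) *\<^sub>R X) *v x)"
    "H (- of_real (node k)) = f (mexp ((- node k / n) *\<^sub>R X) *v x)" for k
    using F(2)[of "node k / n"] F(2)[of "- node k / n"] by (simp_all add: H_def)
  ultimately show ?thesis using n by (simp add: dH sum_distrib_right)
qed

text \<open>Rescaling by 1/n is impossible here; instead the extension is bounded and entire, hence
  constant by Liouville.\<close>

lemma lie_derivative_degree_0:
  assumes "lie_derivative X 0 f g" and x: "norm x \<le> 1"
  shows "g x = 0"
proof -
  obtain C F where F: "F holomorphic_on UNIV" "deriv F 0 = g x" "\<And>z. cmod (F z) \<le> C"
    using lie_derivative_extension[OF assms(1)] x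
    by (metis (no_types, lifting) exp_zero mult.right_neutral mult_zero_left of_nat_0)
  have "F constant_on UNIV"
    using F(1,3) by (intro Liouville_theorem) (auto simp: bounded_iff)
  then obtain c where "F = (\<lambda>z. c)" unfolding constant_on_def by auto
  then show ?thesis using F(2) by simp
qed

section \<open>Bernstein's inequality\<close>

text \<open>Collects what the argument for one generator uses. Contractivity is assumed in place of
  unit length, so the zero matrix is an admissible generator too.\<close>

locale unit_flow =
  fixes \<mu> :: "(real^'n::finite) measure" and p :: ennreal and X :: "'n mat"
  assumes p: "1 \<le> p"
    and finite: "emeasure \<mu> (space \<mu>) < \<infinity>"
    and unit_ball: "\<And>x. x \<in> space \<mu> \<Longrightarrow> norm x \<le> 1"
    and sets_eq: "sets \<mu> = sets (restrict_space borel (space \<mu>))"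
    and orth: "\<And>s. orthogonal_matrix (mexp (s *\<^sub>R X))"
    and contr: "\<And>u. norm (X *v u) \<le> norm u"
    and flow_measurable: "\<And>s. (\<lambda>x. mexp (s *\<^sub>R X) *v x) \<in> measurable \<mu> \<mu>"
    and flow_preserving: "\<And>s. distr \<mu> \<mu> (\<lambda>x. mexp (s *\<^sub>R X) *v x) = \<mu>"
begin

lemma pol_measurable: "pol n f \<Longrightarrow> f \<in> borel_measurable \<mu>"
  using measurable_restrict_space1[OF borel_measurable_continuous_onI[OF continuous_on_pol], of n f "space \<mu>"]
    measurable_cong_sets[OF sets_eq refl, of borel] by blast

lemma compose_flow_measurable:
  "f \<in> borel_measurable \<mu> \<Longrightarrow> (\<lambda>x. f (mexp (s *\<^sub>R X) *v x)) \<in> borel_measurable \<mu>"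
  by (rule measurable_compose[OF flow_measurable])

lemma pol_memLp:
  assumes "pol n f"
  shows "memLp \<mu> p f"
proof -
  obtain g where "lie_derivative X n f g" using pol_has_lie_derivative[OF orth contr assms] by blast
  then obtain B where B: "0 \<le> B" "\<And>x. norm x \<le> 1 \<Longrightarrow> cmod (f x) \<le> B"
    using lie_derivative_bounded by blast
  obtain K where "\<And>f B. f \<in> borel_measurable \<mu> \<Longrightarrow> 0 \<le> B \<Longrightarrow> (\<And>x. x \<in> space \<mu> \<Longrightarrow> cmod (f x) \<le> B)
      \<Longrightarrow> lpnorm \<mu> p f \<le> ennreal (B * K)"
    using lpnorm_le_of_bounded[OF p finite] by blast
  then have "lpnorm \<mu> p f \<le> ennreal (B * K)"
    using B unit_ball pol_measurable[OF assms] by blast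
  then show ?thesis
    using pol_measurable[OF assms] by (auto simp: memLp_def less_top[symmetric] top_unique)
qed

lemma has_gen_lie_derivative:
  assumes D: "lie_derivative X n f g"
  shows "has_gen \<mu> p X f g"
proof -
  have pol: "pol n f" "pol n g" using D by (auto simp: lie_derivative_def)
  obtain B where B: "0 \<le> B" "\<And>x t. norm x \<le> 1 \<Longrightarrow> t \<noteq> 0 \<Longrightarrow> \<bar>t\<bar> \<le> 1 \<Longrightarrow>
      cmod ((f (mexp (t *\<^sub>R X) *v x) - f x) / of_real t - g x) \<le> B * \<bar>t\<bar>"
    using lie_derivative_difference_quotient[OF D] by blast
  obtain K where K: "\<And>f B. f \<in> borel_measurable \<mu> \<Longrightarrow> 0 \<le> B \<Longrightarrow> (\<And>x. x \<in> space \<mu> \<Longrightarrow> cmod (f x) \<le> B)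
      \<Longrightarrow> lpnorm \<mu> p f \<le> ennreal (B * K)"
    using lpnorm_le_of_bounded[OF p finite] by blast
  let ?N = "\<lambda>t::real. lpnorm \<mu> p (\<lambda>x. (f (mexp (t *\<^sub>R X) *v x) - f x) / of_real t - g x)"
  have "eventually (\<lambda>t. ?N t \<le> ennreal (B * \<bar>t\<bar> * K)) (at 0)"
    unfolding eventually_at
  proof (intro exI[of _ 1] conjI ballI impI; (elim conjE)?)
    fix t :: real assume t: "t \<noteq> 0" "dist t 0 < 1"
    show "?N t \<le> ennreal (B * \<bar>t\<bar> * K)"
      using t B unit_ball compose_flow_measurable pol[THEN pol_measurable]
      by (intro K) (auto intro!: borel_measurable_diff borel_measurable_divide)
  qed simp
  moreover have "((\<lambda>t. ennreal (B * \<bar>t\<bar> * K)) \<longlongrightarrow> ennreal (B * \<bar>0\<bar> * K)) (at 0)"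
    by (intro tendsto_ennrealI tendsto_intros)
  ultimately have "(?N \<longlongrightarrow> 0) (at 0)"
    by (intro tendsto_sandwich[of "\<lambda>_. 0" ?N "at 0" "\<lambda>t. ennreal (B * \<bar>t\<bar> * K)"]) auto
  then show ?thesis using pol_memLp pol by (auto simp: has_gen_def)
qed

text \<open>The quotients of \<open>h\<close> minus g' tend to 0 in norm and, almost everywhere, to
  g - g'; by \<open>lpnorm_limit_le\<close> that difference has norm 0. Equality of \<open>h\<close>
  and \<open>f\<close> only almost everywhere is what induction along a chain supplies.\<close>

lemma has_gen_AE_unique:
  assumes D: "lie_derivative X n f g" and h: "AE x in \<mu>. h x = f x" and gen: "has_gen \<mu> p X h g'"
  shows "AE x in \<mu>. g' x = g x"
proof -
  have pol: "pol n f" "pol n g" using D by (auto simp: lie_derivative_def)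
  have meas: "h \<in> borel_measurable \<mu>" "g' \<in> borel_measurable \<mu>" "g \<in> borel_measurable \<mu>"
    using gen pol pol_measurable by (auto simp: has_gen_def memLp_def)
  \<comment> \<open>A countable set of times, so that one null set serves all translates of
    \<open>h\<close>.\<close>
  define t where "t m = 1 / real (Suc m)" for m
  have t: "t m \<noteq> 0" "\<bar>t m\<bar> \<le> 1" for m by (auto simp: t_def)
  have t0: "t \<longlonglongrightarrow> 0" unfolding t_def by (rule LIMSEQ_Suc[OF lim_1_over_n])
  define q where "q m x = (h (mexp (t m *\<^sub>R X) *v x) - h x) / of_real (t m) - g' x" for m x
  have q_meas: "q m \<in> borel_measurable \<mu>" for m
    unfolding q_def using meas compose_flow_measurable
    by (intro borel_measurable_diff borel_measurable_divide) auto
  have "filterlim t (at 0) sequentially"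
    using t0 t by (simp add: filterlim_at)
  then have q0: "(\<lambda>m. lpnorm \<mu> p (q m)) \<longlonglongrightarrow> 0"
    using gen unfolding has_gen_def q_def by (auto dest: filterlim_compose)
  obtain B where B: "0 \<le> B" "\<And>x t. norm x \<le> 1 \<Longrightarrow> t \<noteq> 0 \<Longrightarrow> \<bar>t\<bar> \<le> 1 \<Longrightarrow>
      cmod ((f (mexp (t *\<^sub>R X) *v x) - f x) / of_real t - g x) \<le> B * \<bar>t\<bar>"
    using lie_derivative_difference_quotient[OF D] by blast
  have "AE x in \<mu>. h (mexp (t m *\<^sub>R X) *v x) = f (mexp (t m *\<^sub>R X) *v x)" for m
    using AE_distrD[OF flow_measurable, of "\<lambda>x. h x = f x"] h flow_preserving by metis
  then have "AE x in \<mu>. \<forall>m. h (mexp (t m *\<^sub>R X) *v x) = f (mexp (t m *\<^sub>R X) *v x)"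
    by (simp add: AE_all_countable)
  then have lim: "AE x in \<mu>. (\<lambda>m. q m x) \<longlonglongrightarrow> g x - g' x"
    using h AE_space
  proof eventually_elim
    case (elim x)
    have "(\<lambda>m. (f (mexp (t m *\<^sub>R X) *v x) - f x) / of_real (t m) - g x) \<longlonglongrightarrow> 0"
    proof (rule Lim_null_comparison)
      show "\<forall>\<^sub>F m in sequentially. cmod ((f (mexp (t m *\<^sub>R X) *v x) - f x) / of_real (t m) - g x) \<le> B * \<bar>t m\<bar>"
        using B(2)[OF unit_ball t] elim by (intro always_eventually) auto
      have "(\<lambda>m. B * \<bar>t m\<bar>) \<longlonglongrightarrow> B * \<bar>0\<bar>" by (intro tendsto_intros t0)
      then show "(\<lambda>m. B * \<bar>t m\<bar>) \<longlonglongrightarrow> 0" by simp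
    qed
    from tendsto_add[OF this tendsto_const[of "g x - g' x"]] show ?case
      using elim by (simp add: q_def)
  qed
  have "lpnorm \<mu> p (\<lambda>x. g x - g' x) \<le> 0"
  proof (rule ennreal_le_epsilon)
    fix e :: real assume "0 < e"
    then obtain N where N: "\<And>m. N \<le> m \<Longrightarrow> lpnorm \<mu> p (q m) \<le> ennreal e"
      using order_tendstoD(2)[OF q0, of "ennreal e"]
      by (auto simp: eventually_sequentially dest: less_imp_le)
    have "lpnorm \<mu> p (\<lambda>x. g x - g' x) \<le> ennreal e"
    proof (rule lpnorm_limit_le[OF p, of "\<lambda>m. q (m + N)"])
      show "AE x in \<mu>. (\<lambda>m. q (m + N) x) \<longlonglongrightarrow> g x - g' x"
        using lim by eventually_elim (rule LIMSEQ_ignore_initial_segment)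
    qed (use q_meas meas N \<open>0 < e\<close> in auto)
    then show "lpnorm \<mu> p (\<lambda>x. g x - g' x) \<le> 0 + ennreal e" by simp
  qed
  then have "AE x in \<mu>. g x - g' x = 0"
    using meas by (intro lpnorm_eq_0_imp_AE[OF p]) auto
  then show ?thesis by eventually_elim simp
qed

lemma bernstein_inequality:
  assumes D: "lie_derivative X n f g"
  shows "lpnorm \<mu> p g \<le> ennreal (real n) * lpnorm \<mu> p f"
proof -
  have pol: "pol n f" "pol n g" using D by (auto simp: lie_derivative_def)
  note meas = pol[THEN pol_measurable]
  obtain L where L: "0 \<le> L" "lpnorm \<mu> p f = ennreal L"
    using pol_memLp[OF pol(1)] by (cases "lpnorm \<mu> p f") (auto simp: memLp_def)
  have "lpnorm \<mu> p g \<le> ennreal (real n * L)"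
  proof (cases "n = 0")
    case True
    have "g x = 0" if "x \<in> space \<mu>" for x
      using lie_derivative_degree_0[of X f g x] D unit_ball[OF that] True by simp
    \<comment> \<open>The combination over the empty index set, of total weight 0.\<close>
    then have "lpnorm \<mu> p g \<le> ennreal (0 * L)"
      using L meas
      by (intro lpnorm_convex_combination[OF p, of "{}" "\<lambda>_. 0" 0 "\<lambda>_ _. 0"]) auto
    then show ?thesis using True by simp
  next
    case False
    \<comment> \<open>The second component is 1 or -1 and selects the forward or backward translate;
      both carry the same nonnegative weight, which merges the differences into one convex-type
      sum.\<close>
    define a where "a i = n / (node (fst i))\<^sup>2" for i :: "nat \<times> real"
    define u where "u i x = f (mexp ((snd i * node (fst i) / n) *\<^sub>R X) *v x)" for i x
    define S where "S m x = (\<Sum>k<m. (-1)^k * (u (k, 1) x - u (k, -1) x) * of_real (a (k, 1)))" for m x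
    have u_meas: "u i \<in> borel_measurable \<mu>" for i
      unfolding u_def by (rule compose_flow_measurable[OF meas(1)])
    have S_meas: "S m \<in> borel_measurable \<mu>" for m
      unfolding S_def using u_meas by measurable
    have S_le: "lpnorm \<mu> p (S m) \<le> ennreal (real n * L)" for m
    proof (rule lpnorm_convex_combination[OF p _ _ _ u_meas S_meas L(1)])
      show "finite ({..<m} \<times> {1, -1::real})" by simp
      show "0 \<le> a i" for i by (simp add: a_def)
      have "sum a ({..<m} \<times> {1, -1}) = (\<Sum>k<m. \<Sum>s\<in>{1,-1}. a (k, s))"
        unfolding sum.cartesian_product by (intro sum.cong) auto
      also have "\<dots> = real n * (\<Sum>k<m. 2 / (node k)\<^sup>2)"
        by (simp add: a_def sum_distrib_left mult.commute)
      also have "\<dots> \<le> real n * 1" using sum_node_le by (intro mult_left_mono) auto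
      finally show "sum a ({..<m} \<times> {1, -1}) \<le> real n" by simp
      show "lpnorm \<mu> p (u i) \<le> ennreal L" for i
        unfolding u_def using L
        by (intro lpnorm_compose[OF p flow_measurable flow_preserving meas(1)]) auto
    next
      fix x
      have "cmod (S m x) \<le> (\<Sum>k<m. (cmod (u (k, 1) x) + cmod (u (k, -1) x)) * a (k, 1))"
        unfolding S_def
      proof (rule sum_norm_le)
        fix k
        have "0 \<le> a (k, 1)" by (simp add: a_def)
        then show "cmod ((-1)^k * (u (k, 1) x - u (k, -1) x) * of_real (a (k, 1)))
            \<le> (cmod (u (k, 1) x) + cmod (u (k, -1) x)) * a (k, 1)"
          using norm_triangle_ineq4[of "u (k, 1) x" "u (k, -1) x"]
          by (simp add: norm_mult norm_power mult_right_mono)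
      qed
      also have "\<dots> = (\<Sum>k<m. \<Sum>s\<in>{1,-1}. a (k, s) * cmod (u (k, s) x))"
        by (simp add: a_def algebra_simps)
      also have "\<dots> = (\<Sum>i\<in>{..<m} \<times> {1, -1}. a i * cmod (u i x))"
        unfolding sum.cartesian_product by (intro sum.cong) auto
      finally show "cmod (S m x) \<le> (\<Sum>i\<in>{..<m} \<times> {1, -1}. a i * cmod (u i x))" .
    qed
    have S_lim: "(\<lambda>m. S m x) \<longlonglongrightarrow> g x" if "x \<in> space \<mu>" for x
      using lie_derivative_interpolation[OF D unit_ball[OF that]] False
      by (simp add: S_def u_def a_def)
    show ?thesis
      by (rule lpnorm_limit_le[OF p S_meas meas(2) _ S_le AE_I2[OF S_lim]]) (simp_all add: L)
  qed
  then show ?thesis using L by (simp add: ennreal_mult)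
qed

end

text \<open>The head of the list acts last, so induction on the list appends one generator to a
  polynomial \<open>Q\<close> already obtained. Since \<open>Q\<close> again has degree at most
  \<open>n\<close>, each generator costs the same factor. Membership of \<open>P\<close> in L_p is
  assumed separately because the empty word provides no flow to derive it from.\<close>

lemma gen_chain_pol:
  fixes Xs :: "nat \<Rightarrow> 'n::finite mat"
  assumes flow: "\<And>j. j \<in> set js \<Longrightarrow> unit_flow \<mu> p (Xs j)" and P: "pol n P" "memLp \<mu> p P"
  shows "\<exists>Q. pol n Q \<and> gen_chain \<mu> p Xs js P Q \<and>
    (\<forall>g. gen_chain \<mu> p Xs js P g \<longrightarrow> g \<in> borel_measurable \<mu> \<and> (AE x in \<mu>. g x = Q x)) \<and>
    Q \<in> borel_measurable \<mu> \<and>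
    lpnorm \<mu> p Q \<le> ennreal (real n ^ length js) * lpnorm \<mu> p P"
  using flow
proof (induction js)
  case Nil
  then show ?case using P by (auto simp: memLp_def)
next
  case (Cons j js)
  then obtain Q where Q: "pol n Q" "gen_chain \<mu> p Xs js P Q"
    "\<And>h. gen_chain \<mu> p Xs js P h \<Longrightarrow> AE x in \<mu>. h x = Q x"
    "lpnorm \<mu> p Q \<le> ennreal (real n ^ length js) * lpnorm \<mu> p P" by auto
  interpret unit_flow \<mu> p "Xs j" using Cons.prems by simp
  obtain R where R: "lie_derivative (Xs j) n Q R"
    using pol_has_lie_derivative[OF orth contr Q(1)] by blast
  then have "pol n R" by (simp add: lie_derivative_def)
  moreover have "gen_chain \<mu> p Xs (j # js) P R"
    using Q(2) has_gen_lie_derivative[OF R] by auto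
  moreover have "g \<in> borel_measurable \<mu> \<and> (AE x in \<mu>. g x = R x)" if "gen_chain \<mu> p Xs (j # js) P g" for g
    using that has_gen_AE_unique[OF R Q(3)] by (auto simp: has_gen_def memLp_def)
  moreover have "lpnorm \<mu> p R \<le> ennreal (real n ^ length (j # js)) * lpnorm \<mu> p P"
  proof -
    have "lpnorm \<mu> p R \<le> ennreal (real n) * lpnorm \<mu> p Q" by (rule bernstein_inequality[OF R])
    also have "\<dots> \<le> ennreal (real n) * (ennreal (real n ^ length js) * lpnorm \<mu> p P)"
      by (intro mult_left_mono Q(4)) simp
    finally show ?thesis by (simp add: ennreal_mult mult.assoc)
  qed
  ultimately show ?case using pol_measurable[of n R] by blast
qed

text \<open>Invariance is given for images of sets, while \<open>distr\<close> measures preimages.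
  Since the inverse of \<open>g\<close> also maps the orbit to itself, the preimage B of A satisfies
  gB = A, and the two notions agree.\<close>

lemma invariant_measure_preserving:
  fixes G :: "'n::finite mat set"
  assumes G: "closed_orth_subgroup G" and \<mu>: "invariant_measure G ((\<lambda>g. g *v v) ` G) \<mu>" and g: "g \<in> G"
  shows "(\<lambda>x. g *v x) \<in> measurable \<mu> \<mu>" "distr \<mu> \<mu> (\<lambda>x. g *v x) = \<mu>"
proof -
  have sets: "sets \<mu> = sets (restrict_space borel (space \<mu>))" and sp: "space \<mu> = (\<lambda>g. g *v v) ` G"
    and inv: "\<And>A. A \<in> sets \<mu> \<Longrightarrow> emeasure \<mu> ((\<lambda>x. g *v x) ` A) = emeasure \<mu> A"
    using \<mu> g by (auto simp: invariant_measure_def)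
  have closed: "h *v x \<in> space \<mu>" if "h \<in> G" "x \<in> space \<mu>" for h x
    using G that unfolding sp closed_orth_subgroup_def by (auto simp: matrix_vector_mul_assoc)
  have "(\<lambda>x. g *v x) \<in> measurable (restrict_space borel (space \<mu>)) (restrict_space borel (space \<mu>))"
    using closed[OF g]
    by (intro measurable_restrict_space3 borel_measurable_continuous_onI)
       (auto intro!: linear_continuous_on matrix_vector_mul_bounded_linear)
  then show meas: "(\<lambda>x. g *v x) \<in> measurable \<mu> \<mu>"
    using measurable_cong_sets[OF sets sets] by blast
  show "distr \<mu> \<mu> (\<lambda>x. g *v x) = \<mu>"
  proof (rule measure_eqI)
    fix A assume "A \<in> sets (distr \<mu> \<mu> ((*v) g))"
    then have A: "A \<in> sets \<mu>" by simp
    define B where "B = (\<lambda>x. g *v x) -` A \<inter> space \<mu>"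
    have B: "B \<in> sets \<mu>" unfolding B_def by (rule measurable_sets[OF meas A])
    have "orthogonal_matrix g" and inv_G: "matrix_inv g \<in> G"
      using G g unfolding closed_orth_subgroup_def by blast+
    \<comment> \<open>\<open>matrix_inv\<close> is a choice operator; the transpose witnesses that a
      two-sided inverse exists.\<close>
    then have "g ** transpose g = mat 1 \<and> transpose g ** g = mat 1"
      by (simp add: orthogonal_matrix_def)
    then have "g ** matrix_inv g = mat 1"
      unfolding matrix_inv_def by (rule someI2) blast
    then have "a \<in> (\<lambda>x. g *v x) ` B" if "a \<in> A" for a
      using that closed[OF inv_G, of a] sets.sets_into_space[OF A]
      by (intro image_eqI[of _ _ "matrix_inv g *v a"])
         (auto simp: B_def matrix_vector_mul_assoc)
    then have "(\<lambda>x. g *v x) ` B = A" by (auto simp: B_def)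
    then show "emeasure (distr \<mu> \<mu> ((*v) g)) A = emeasure \<mu> A"
      using inv[OF B] by (simp add: emeasure_distr[OF meas A] B_def)
  qed simp
qed

theorem theorem2p3:
  fixes G :: "(real^'n::finite^'n) set" and v :: "real^'n"
    and \<mu> :: "(real^'n) measure" and d :: nat and Xs :: "nat \<Rightarrow> real^'n^'n"
    and p :: ennreal and n :: nat and P :: "real^'n \<Rightarrow> complex"
  assumes "closed_orth_subgroup G"
    and "norm v = 1"
    and "symmetric_pair G (stabilizer G v)"
    and "invariant_measure G ((\<lambda>g. g *v v) ` G) \<mu>"
    and "lie_onb G d Xs"
    and "1 \<le> p"
    and "poly_deg_le n P"
  shows "P \<in> bernstein_space \<mu> p d Xs (real n)"
proof -
  have space: "space \<mu> = (\<lambda>g. g *v v) ` G" using assms(4) by (simp add: invariant_measure_def)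
  have orth_G: "orthogonal_matrix g" if "g \<in> G" for g
    using assms(1) that by (auto simp: closed_orth_subgroup_def)
  have flow: "unit_flow \<mu> p X" if X: "X \<in> lie_alg G" "\<And>u. norm (X *v u) \<le> norm u" for X
  proof -
    have exp_G: "mexp (s *\<^sub>R X) \<in> G" for s using X by (simp add: lie_alg_def)
    show ?thesis
    proof
      show "norm x \<le> 1" if "x \<in> space \<mu>" for x
        using that assms(2) orth_G by (auto simp: space norm_orthogonal_matrix_mult_vec)
    qed (use assms(4,6) X orth_G exp_G invariant_measure_preserving[OF assms(1,4)]
        in \<open>auto simp: invariant_measure_def\<close>)
  qed
  \<comment> \<open>The zero generator gives membership in L_p also when d = 0.\<close>
  have zero_gen: "0 \<in> lie_alg G"
  proof -
    have "mexp (0 *\<^sub>R 0) = (mat 1 :: real^'n^'n)"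
      using mexp_0_mult_vec[of "0 :: real^'n^'n"] by (subst matrix_eq) simp
    then show ?thesis using assms(1) by (auto simp: lie_alg_def closed_orth_subgroup_def)
  qed
  have pol: "pol n P" by (rule poly_deg_le_imp_pol[OF assms(7)])
  have "memLp \<mu> p P"
    using unit_flow.pol_memLp[OF flow[OF zero_gen] pol] by simp
  moreover have "(\<exists>g. gen_chain \<mu> p Xs js P g) \<and>
      (\<forall>g. gen_chain \<mu> p Xs js P g \<longrightarrow> lpnorm \<mu> p g \<le> ennreal (real n ^ length js) * lpnorm \<mu> p P)"
    if js: "set js \<subseteq> {..<d}" for js
  proof -
    have flows: "unit_flow \<mu> p (Xs j)" if "j \<in> set js" for j
    proof -
      have "Xs j \<in> lie_alg G" "lie_inner (Xs j) (Xs j) = 1"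
        using assms(5) js that by (auto simp: lie_onb_def)
      moreover from this have "orthogonal_matrix (mexp (s *\<^sub>R Xs j))" for s
        using orth_G by (auto simp: lie_alg_def)
      ultimately show ?thesis using flow unit_generator_contractive by blast
    qed
    obtain Q where
      Q: "gen_chain \<mu> p Xs js P Q" "Q \<in> borel_measurable \<mu>"
        "lpnorm \<mu> p Q \<le> ennreal (real n ^ length js) * lpnorm \<mu> p P"
      and unique: "\<And>g. gen_chain \<mu> p Xs js P g \<Longrightarrow> g \<in> borel_measurable \<mu> \<and> (AE x in \<mu>. g x = Q x)"
      using gen_chain_pol[of js \<mu> p Xs n P, OF flows pol \<open>memLp \<mu> p P\<close>] by blast
    \<comment> \<open>\<open>bernstein_space\<close> demands the bound for every value of the chain;
      each has the norm of the polynomial representative.\<close>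
    have norm_eq: "lpnorm \<mu> p g = lpnorm \<mu> p Q" if "gen_chain \<mu> p Xs js P g" for g
      using unique[OF that] Q(2) by (intro lpnorm_AE_cong) auto
    show ?thesis
    proof (intro conjI exI[of _ Q] allI impI)
      fix g assume "gen_chain \<mu> p Xs js P g"
      then show "lpnorm \<mu> p g \<le> ennreal (real n ^ length js) * lpnorm \<mu> p P"
        using norm_eq Q(3) by simp
    qed (rule Q(1))
  qed
  ultimately show ?thesis by (simp add: bernstein_space_def)
qed

end
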